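(* Let $\Omega$ and $\Omega'$ be aperiodic repetitive tiling spaces of $\mathbb{R}^d$ with finite local complexity, and let $h:\Omega\to\Omega'$ be a homeomorphism. Then $h$ is an orbit equivalence (it maps each $\mathbb{R}^d$-orbit of $\Omega$ onto an $\mathbb{R}^d$-orbit of $\Omega'$). Furthermore, for all $T\in\Omega$, the cocycle $h_T:\mathbb{R}^d\to\mathbb{R}^d$ defined by $$h(T-x)=h(T)-h_T(x)\qquad(x\in\mathbb{R}^d)$$ is a homeomorphism from $\mathbb{R}^d$ onto itself, and there are constants $M,C>0$, which do not depend on $T$, such that for all $T\in\Omega$ and all $x\in\mathbb{R}^d$, $$\|h_T(x)\|\le M\|x\|+C.$$
   Context: Tilings. A tile is a compact subset of $\mathbb{R}^d$ homeomorphic to a closed ball and equal to the closure of its interior (possibly decorated with a label); a prototile is an equivalence class of tiles under translation. For each tiling space a finite collection of prototiles is fixed. A tiling is a collection $T=\{t_i\}_{i\in I}$ of tiles whose translation classes are in this collection, whose union is $\mathbb{R}^d$, and such that $t_i\cap t_j$ has empty interior for $i\neq j$. For $x\in\mathbb{R}^d$, $T-x=\{t_i-x\}_{i\in I}$ (tilings are not identified with their translates). $B(x,r)$ is the ball of centre $x$ and radius $r$, and $T\cap B(x,r)$ denotes the patch of all tiles of $T$ which intersect $B(x,r)$. $T$ is aperiodic if $T-x\neq T$ for all $x\neq 0$; $T$ has finite local complexity (FLC) if for all $R>0$ there are finitely many patches $T\cap B(x,R)$, $x\in\mathbb{R}^d$, up to translation; $T$ is repetitive if for every finite patch $P\subset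 T$ there is $R>0$ such that a translate of $P$ appears in $T\cap B(x,R)$ for every $x\in\mathbb{R}^d$. Tiling spaces. Define a distance on tilings with the given prototiles by letting $D(T_1,T_2)$ be the minimum of $1/\sqrt2$ and the infimum of all $\varepsilon>0$ for which there are $x_1,x_2\in\mathbb{R}^d$ with $\|x_i\|\le\varepsilon$ such that $T_1-x_1$ and $T_2-x_2$ agree on $B(0,1/\varepsilon)$. The hull (tiling space) of $T$ is the closure $\Omega=\overline{\{T-x : x\in\mathbb{R}^d\}}$ for $D$; $\mathbb{R}^d$ acts continuously on it by translation. An aperiodic repetitive tiling space with FLC is the hull of an aperiodic, repetitive tiling with FLC. *)

theory Defs
  imports "HOL-Analysis.Analysis"
begin

section \<open>Tiles and tilings\<close>

text \<open>
  A tile is its support together with a label; undecorated tiles are the instance in which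
  the label type is \<^typ>\<open>unit\<close>.
\<close>

type_synonym ('n, 'l) tile = "(real ^ 'n) set \<times> 'l"

definition is_tile :: "('n::finite, 'l) tile \<Rightarrow> bool" where
  "is_tile t \<longleftrightarrow>
     compact (fst t) \<and>
     fst t homeomorphic cball (0 :: real ^ 'n) 1 \<and>
     fst t = closure (interior (fst t))"

definition tile_minus :: "('n::finite, 'l) tile \<Rightarrow> real ^ 'n \<Rightarrow> ('n, 'l) tile" where
  "tile_minus t x = ((\<lambda>y. y - x) ` fst t, snd t)"

definition shift :: "('n::finite, 'l) tile set \<Rightarrow> real ^ 'n \<Rightarrow> ('n, 'l) tile set"
    (infixl \<open>\<ominus>\<close> 65) where
  "T \<ominus> x = (\<lambda>t. tile_minus t x) ` T"

definition tile_translation :: "(('n::finite, 'l) tile \<times> ('n, 'l) tile) set" where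
  "tile_translation = {(s, t). \<exists>x. t = tile_minus s x}"

definition prototile_collection :: "('n::finite, 'l) tile set set \<Rightarrow> bool" where
  "prototile_collection P \<longleftrightarrow> finite P \<and> P \<subseteq> {t. is_tile t} // tile_translation"

text \<open>
  Since a tile has non-empty interior, the members of a family of tiles with pairwise
  interior-disjoint supports are distinct, so a tiling may be taken to be a set of tiles.
\<close>

definition tiling :: "('n::finite, 'l) tile set set \<Rightarrow> ('n, 'l) tile set \<Rightarrow> bool" where
  "tiling P T \<longleftrightarrow>
     T \<subseteq> \<Union>P \<and>
     (\<Union>t\<in>T. fst t) = UNIV \<and>
     (\<forall>s\<in>T. \<forall>t\<in>T. s \<noteq> t \<longrightarrow> interior (fst s \<inter> fst t) = {})"

definition patch :: "('n::finite, 'l) tile set \<Rightarrow> real ^ 'n \<Rightarrow> real \<Rightarrow> ('n, 'l) tile set" where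
  "patch T x r = {t \<in> T. fst t \<inter> cball x r \<noteq> {}}"

definition aperiodic :: "('n::finite, 'l) tile set \<Rightarrow> bool" where
  "aperiodic T \<longleftrightarrow> (\<forall>x. x \<noteq> 0 \<longrightarrow> T \<ominus> x \<noteq> T)"

definition patch_translation :: "(('n::finite, 'l) tile set \<times> ('n, 'l) tile set) set" where
  "patch_translation = {(Q, Q'). \<exists>x. Q' = Q \<ominus> x}"

definition finite_local_complexity :: "('n::finite, 'l) tile set \<Rightarrow> bool" where
  "finite_local_complexity T \<longleftrightarrow>
     (\<forall>R>0. finite (range (\<lambda>x. patch T x R) // patch_translation))"

definition repetitive :: "('n::finite, 'l) tile set \<Rightarrow> bool" where
  "repetitive T \<longleftrightarrow>
     (\<forall>Q. Q \<subseteq> T \<and> finite Q \<longrightarrow> (\<exists>R>0. \<forall>x. \<exists>y. Q \<ominus> y \<subseteq> patch T x R))"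

section \<open>Tiling spaces\<close>

definition agree_up_to :: "('n::finite, 'l) tile set \<Rightarrow> ('n, 'l) tile set \<Rightarrow> real \<Rightarrow> bool" where
  "agree_up_to T1 T2 e \<longleftrightarrow>
     (\<exists>x1 x2. norm x1 \<le> e \<and> norm x2 \<le> e \<and>
        patch (T1 \<ominus> x1) 0 (1 / e) = patch (T2 \<ominus> x2) 0 (1 / e))"

text \<open>
  The bound $1/\sqrt2$ is put inside the infimum because the set of admissible $\varepsilon$
  may be empty (two tilings using different prototiles), and the infimum of the empty set of
  reals is unspecified; with the convention $\inf\emptyset=\infty$ this is
  $\min(1/\sqrt2, \inf\ldots)$.
\<close>

definition tiling_dist :: "('n::finite, 'l) tile set \<Rightarrow> ('n, 'l) tile set \<Rightarrow> real" where
  "tiling_dist T1 T2 = Inf (insert (1 / sqrt 2) {e. e > 0 \<and> agree_up_to T1 T2 e})"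

text \<open>This is the topology of a metric: see \<open>Metric_space_tiling\<close> below.\<close>

definition tiling_topology :: "('n::finite, 'l) tile set set \<Rightarrow> ('n, 'l) tile set topology" where
  "tiling_topology P = Metric_space.mtopology {T. tiling P T} tiling_dist"

definition orbit :: "('n::finite, 'l) tile set \<Rightarrow> ('n, 'l) tile set set" where
  "orbit T = range (\<lambda>x. T \<ominus> x)"

definition tiling_space ::
    "('n::finite, 'l) tile set set \<Rightarrow> ('n, 'l) tile set \<Rightarrow> ('n, 'l) tile set set" where
  "tiling_space P T = tiling_topology P closure_of orbit T"

definition tiling_space_topology ::
    "('n::finite, 'l) tile set set \<Rightarrow> ('n, 'l) tile set set \<Rightarrow> ('n, 'l) tile set topology" where
  "tiling_space_topology P \<Omega> = subtopology (tiling_topology P) \<Omega>"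

definition aperiodic_repetitive_FLC_space ::
    "('n::finite, 'l) tile set set \<Rightarrow> ('n, 'l) tile set set \<Rightarrow> bool" where
  "aperiodic_repetitive_FLC_space P \<Omega> \<longleftrightarrow>
     prototile_collection P \<and>
     (\<exists>T. tiling P T \<and> aperiodic T \<and> repetitive T \<and> finite_local_complexity T \<and>
          \<Omega> = tiling_space P T)"

definition is_cocycle ::
    "(('n::finite, 'l) tile set \<Rightarrow> ('n, 'm) tile set) \<Rightarrow> ('n, 'l) tile set \<Rightarrow>
     (real ^ 'n \<Rightarrow> real ^ 'n) \<Rightarrow> bool" where
  "is_cocycle h T g \<longleftrightarrow> (\<forall>x. h (T \<ominus> x) = h T \<ominus> g x)"

section \<open>The distance on tilings is a metric\<close>

lemma tile_minus_0 [simp]: "tile_minus t 0 = t"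
  by (simp add: tile_minus_def)

lemma tile_minus_minus [simp]: "tile_minus (tile_minus t x) y = tile_minus t (x + y)"
  by (simp add: tile_minus_def image_image algebra_simps)

lemma mem_shift_iff: "t \<in> T \<ominus> x \<longleftrightarrow> tile_minus t (- x) \<in> T"
proof
  assume "tile_minus t (- x) \<in> T"
  then have "tile_minus (tile_minus t (- x)) x \<in> T \<ominus> x"
    unfolding shift_def by blast
  then show "t \<in> T \<ominus> x" by simp
qed (auto simp: shift_def)

lemma tile_minus_meets_cball:
  assumes "fst t \<inter> cball z r \<noteq> {}" "r + norm x \<le> r'"
  shows "fst (tile_minus t x) \<inter> cball z r' \<noteq> {}"
proof -
  obtain y where y: "y \<in> fst t" "dist z y \<le> r" using assms(1) by auto
  have "dist z (y - x) \<le> dist z y + norm x"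
    using dist_triangle[of z "y - x" y] by (simp add: dist_norm)
  then show ?thesis
    using y assms(2) by (force simp: tile_minus_def)
qed

lemma agree_up_to_sym: "agree_up_to T1 T2 e \<Longrightarrow> agree_up_to T2 T1 e"
  unfolding agree_up_to_def by metis

lemma patch_transfer:
  assumes eq1: "patch (T1 \<ominus> x1) 0 r1 = patch (T2 \<ominus> x2) 0 r1"
    and eq2: "patch (T2 \<ominus> y2) 0 r2 = patch (T3 \<ominus> y3) 0 r2"
    and r: "r + norm y2 \<le> r1" "r + norm x2 \<le> r2"
  shows "patch (T1 \<ominus> (x1 + y2)) 0 r \<subseteq> patch (T3 \<ominus> (y3 + x2)) 0 r"
proof
  fix t assume "t \<in> patch (T1 \<ominus> (x1 + y2)) 0 r"
  then have t: "tile_minus t (- (x1 + y2)) \<in> T1" "fst t \<inter> cball 0 r \<noteq> {}"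
    by (auto simp: patch_def mem_shift_iff)
  have "tile_minus t (- y2) \<in> patch (T1 \<ominus> x1) 0 r1"
    using t tile_minus_meets_cball[OF t(2), of "- y2" r1] r
    by (simp add: patch_def mem_shift_iff add.commute)
  then have "tile_minus t (- y2) \<in> T2 \<ominus> x2"
    unfolding eq1 by (simp add: patch_def)
  then have "tile_minus t (- x2) \<in> patch (T2 \<ominus> y2) 0 r2"
    using tile_minus_meets_cball[OF t(2), of "- x2" r2] r
    by (simp add: patch_def mem_shift_iff add.commute)
  then have "tile_minus t (- x2) \<in> T3 \<ominus> y3"
    unfolding eq2 by (simp add: patch_def)
  then show "t \<in> patch (T3 \<ominus> (y3 + x2)) 0 r"
    using t by (simp add: patch_def mem_shift_iff add.commute)
qed

lemma agree_up_to_trans: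
  assumes "agree_up_to T1 T2 a" "agree_up_to T2 T3 b" and pos: "a > 0" "b > 0" and "a + b \<le> 1"
  shows "agree_up_to T1 T3 (a + b)"
proof -
  obtain x1 x2 where x: "norm x1 \<le> a" "norm x2 \<le> a"
    "patch (T1 \<ominus> x1) 0 (1 / a) = patch (T2 \<ominus> x2) 0 (1 / a)"
    using assms(1) by (auto simp: agree_up_to_def)
  obtain y2 y3 where y: "norm y2 \<le> b" "norm y3 \<le> b"
    "patch (T2 \<ominus> y2) 0 (1 / b) = patch (T3 \<ominus> y3) 0 (1 / b)"
    using assms(2) by (auto simp: agree_up_to_def)
  have key: "1 / (u + v) + v \<le> 1 / u" if "u > 0" "v > 0" "u + v \<le> 1" for u v :: real
  proof -
    have "1 / u - 1 / (u + v) = v / (u * (u + v))"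
      using that by (simp add: field_simps)
    moreover have "u * (u + v) \<le> 1"
      using that by (intro mult_le_one) auto
    then have "v / 1 \<le> v / (u * (u + v))"
      using that by (intro divide_left_mono) auto
    ultimately show ?thesis by simp
  qed
  have r: "1 / (a + b) + norm y2 \<le> 1 / a" "1 / (a + b) + norm x2 \<le> 1 / b"
    using key[of a b] key[of b a] x y assms(3-5) by (auto simp: add.commute)
  have "patch (T1 \<ominus> (x1 + y2)) 0 (1 / (a + b)) = patch (T3 \<ominus> (y3 + x2)) 0 (1 / (a + b))"
    using patch_transfer[OF x(3) y(3) r] patch_transfer[OF y(3)[symmetric] x(3)[symmetric] r(2,1)]
    by blast
  moreover have "norm (x1 + y2) \<le> a + b" "norm (y3 + x2) \<le> a + b"
    using x y norm_triangle_ineq[of x1 y2] norm_triangle_ineq[of y3 x2] by auto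
  ultimately show ?thesis
    unfolding agree_up_to_def by blast
qed

lemma bdd_below_dist_set: "bdd_below (insert (1 / sqrt 2) {e. e > 0 \<and> agree_up_to T1 T2 e})"
  by (rule bdd_belowI[of _ 0]) auto

lemma tiling_dist_nonneg: "tiling_dist T1 T2 \<ge> 0"
  unfolding tiling_dist_def by (rule cInf_greatest) auto

lemma tiling_dist_le_sqrt: "tiling_dist T1 T2 \<le> 1 / sqrt 2"
  unfolding tiling_dist_def by (rule cInf_lower[OF _ bdd_below_dist_set]) auto

lemma tiling_dist_le: "e > 0 \<Longrightarrow> agree_up_to T1 T2 e \<Longrightarrow> tiling_dist T1 T2 \<le> e"
  unfolding tiling_dist_def by (rule cInf_lower[OF _ bdd_below_dist_set]) auto

lemma tiling_dist_sym: "tiling_dist T1 T2 = tiling_dist T2 T1"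
  unfolding tiling_dist_def using agree_up_to_sym by metis

lemma tiling_dist_lessE:
  assumes "tiling_dist T1 T2 < c" "c \<le> 1 / sqrt 2"
  obtains e where "0 < e" "e < c" "agree_up_to T1 T2 e"
proof -
  obtain e where "e \<in> insert (1 / sqrt 2) {e. e > 0 \<and> agree_up_to T1 T2 e}" "e < c"
    using assms(1) cInf_lessD[OF insert_not_empty] unfolding tiling_dist_def by metis
  then show ?thesis using that assms(2) by auto
qed

lemma tiling_dist_triangle: "tiling_dist T1 T3 \<le> tiling_dist T1 T2 + tiling_dist T2 T3"
proof (rule ccontr)
  assume neg: "\<not> ?thesis"
  define \<eta> where "\<eta> = (tiling_dist T1 T3 - (tiling_dist T1 T2 + tiling_dist T2 T3)) / 2"
  have \<eta>: "\<eta> > 0" using neg by (simp add: \<eta>_def)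
  have bnd: "tiling_dist T1 T2 + \<eta> + (tiling_dist T2 T3 + \<eta>) = tiling_dist T1 T3"
    by (simp add: \<eta>_def field_simps)
  have le: "tiling_dist T1 T2 + \<eta> \<le> 1 / sqrt 2" "tiling_dist T2 T3 + \<eta> \<le> 1 / sqrt 2"
    using bnd tiling_dist_le_sqrt[of T1 T3] tiling_dist_nonneg[of T1 T2]
      tiling_dist_nonneg[of T2 T3] \<eta> by linarith+
  obtain a where a: "0 < a" "a < tiling_dist T1 T2 + \<eta>" "agree_up_to T1 T2 a"
    using tiling_dist_lessE[OF _ le(1)] \<eta> by (metis less_add_same_cancel1)
  obtain b where b: "0 < b" "b < tiling_dist T2 T3 + \<eta>" "agree_up_to T2 T3 b"
    using tiling_dist_lessE[OF _ le(2)] \<eta> by (metis less_add_same_cancel1)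
  have lt: "a + b < tiling_dist T1 T3" using a b bnd by linarith
  moreover have "1 / sqrt 2 \<le> (1::real)" by simp
  ultimately have "a + b \<le> 1" using tiling_dist_le_sqrt[of T1 T3] by linarith
  then have "tiling_dist T1 T3 \<le> a + b"
    using agree_up_to_trans[OF a(3) b(3) a(1) b(1)] a b by (intro tiling_dist_le) auto
  then show False using lt by simp
qed

lemma tile_interior_nonempty: "is_tile t \<Longrightarrow> interior (fst t) \<noteq> {}"
proof
  assume t: "is_tile t" and "interior (fst t) = {}"
  then have "fst t = {}" unfolding is_tile_def by (metis closure_empty)
  then show False using t homeomorphic_empty(2) unfolding is_tile_def
    by (metis cball_eq_empty homeomorphic_sym not_one_less_zero)
qed

lemma prototile_uniform:
  assumes "prototile_collection P"
  obtains \<rho> \<delta> where "\<rho> > 0"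
    "\<And>t. t \<in> \<Union>P \<Longrightarrow> (\<exists>c. ball c \<rho> \<subseteq> fst t)"
    "\<And>t a b. t \<in> \<Union>P \<Longrightarrow> a \<in> fst t \<Longrightarrow> b \<in> fst t \<Longrightarrow> dist a b \<le> \<delta>"
proof -
  have "\<exists>\<rho> \<delta>. \<rho> > 0 \<and> (\<forall>t\<in>p. (\<exists>c. ball c \<rho> \<subseteq> fst t) \<and> (\<forall>a\<in>fst t. \<forall>b\<in>fst t. dist a b \<le> \<delta>))"
    if p: "p \<in> P" for p
  proof -
    obtain s where s: "is_tile s" "p = tile_translation `` {s}"
      using assms p unfolding prototile_collection_def quotient_def by blast
    obtain c where "c \<in> interior (fst s)" using tile_interior_nonempty[OF s(1)] by blast
    then obtain \<rho> where \<rho>: "\<rho> > 0" "ball c \<rho> \<subseteq> fst s" using mem_interior by blast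
    have "bounded (fst s)" using s(1) compact_imp_bounded is_tile_def by blast
    then obtain \<delta> where \<delta>: "\<And>a b. a \<in> fst s \<Longrightarrow> b \<in> fst s \<Longrightarrow> dist a b \<le> \<delta>"
      using diameter_bounded_bound by metis
    have "(\<exists>c. ball c \<rho> \<subseteq> fst t) \<and> (\<forall>a\<in>fst t. \<forall>b\<in>fst t. dist a b \<le> \<delta>)" if t: "t \<in> p" for t
    proof -
      obtain x where x: "fst t = (\<lambda>y. y - x) ` fst s"
        using t s(2) by (auto simp: tile_translation_def tile_minus_def)
      have "ball (c - x) \<rho> \<subseteq> fst t"
      proof
        fix y assume "y \<in> ball (c - x) \<rho>"
        then have "y + x \<in> fst s" using \<rho>(2) by (auto simp: dist_norm algebra_simps)
        then show "y \<in> fst t" unfolding x by (metis add_diff_cancel_right' imageI)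
      qed
      then show ?thesis using \<delta> by (auto simp: x dist_norm)
    qed
    then show ?thesis using \<rho> by blast
  qed
  then obtain r d where rd: "\<And>p. p \<in> P \<Longrightarrow> r p > 0 \<and>
      (\<forall>t\<in>p. (\<exists>c. ball c (r p) \<subseteq> fst t) \<and> (\<forall>a\<in>fst t. \<forall>b\<in>fst t. dist a b \<le> d p))"
    by metis
  have fin: "finite P" using assms prototile_collection_def by blast
  define \<rho> where "\<rho> = Min (insert 1 (r ` P))"
  define \<delta> where "\<delta> = Max (insert 1 (d ` P))"
  show ?thesis
  proof
    show "\<rho> > 0" unfolding \<rho>_def using fin rd by (subst Min_gr_iff) auto
    fix t assume "t \<in> \<Union>P"
    then obtain p where p: "p \<in> P" "t \<in> p" by blast
    have le: "\<rho> \<le> r p" "d p \<le> \<delta>" using fin p unfolding \<rho>_def \<delta>_def by auto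
    show "\<exists>c. ball c \<rho> \<subseteq> fst t" using rd[OF p(1)] p(2) le subset_ball by (meson subset_trans)
    show "dist a b \<le> \<delta>" if "a \<in> fst t" "b \<in> fst t" for a b
      using rd[OF p(1)] p(2) le that by fastforce
  qed
qed

lemma finite_patch:
  assumes P: "prototile_collection P" and T: "tiling P T"
  shows "finite (patch T x r)"
proof -
  obtain \<rho> \<delta> where \<rho>: "\<rho> > 0" and in_ball: "\<And>t. t \<in> \<Union>P \<Longrightarrow> (\<exists>c. ball c \<rho> \<subseteq> fst t)"
    and diam: "\<And>t a b. t \<in> \<Union>P \<Longrightarrow> a \<in> fst t \<Longrightarrow> b \<in> fst t \<Longrightarrow> dist a b \<le> \<delta>"
    using prototile_uniform[OF P] by blast
  have TP: "\<And>t. t \<in> T \<Longrightarrow> t \<in> \<Union>P" using T by (auto simp: tiling_def)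
  obtain c where c: "\<And>t. t \<in> T \<Longrightarrow> ball (c t) \<rho> \<subseteq> fst t" using in_ball TP by metis
  have sep: "s = t" if "s \<in> T" "t \<in> T" "dist (c s) (c t) < \<rho>" for s t
  proof (rule ccontr)
    assume "s \<noteq> t"
    then have "interior (fst s) \<inter> interior (fst t) = {}"
      using T that by (auto simp: tiling_def)
    moreover have "c t \<in> interior (fst s)"
      using c[OF that(1)] that(3) by (meson interior_maximal mem_ball open_ball subsetD)
    moreover have "c t \<in> interior (fst t)"
      using c[OF that(2)] \<rho> by (meson interior_maximal centre_in_ball open_ball subsetD)
    ultimately show False by blast
  qed
  define K where "K = cball x (r + \<delta>)"
  have cK: "c t \<in> K" if t: "t \<in> patch T x r" for t
  proof -
    obtain y where y: "t \<in> T" "y \<in> fst t" "dist x y \<le> r" using t by (auto simp: patch_def)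
    have "c t \<in> fst t" using c[OF y(1)] \<rho> by (meson centre_in_ball subsetD)
    then have "dist y (c t) \<le> \<delta>" using diam TP y by blast
    then show ?thesis using y dist_triangle[of x "c t" y] by (simp add: K_def)
  qed
  obtain F where F: "finite F" "K \<subseteq> (\<Union>z\<in>F. ball z (\<rho> / 2))"
  proof -
    have "compact K" by (simp add: K_def)
    moreover have "\<rho> / 2 > 0" using \<rho> by simp
    ultimately show ?thesis using that unfolding compact_eq_totally_bounded by blast
  qed
  then have "\<forall>t\<in>patch T x r. \<exists>z\<in>F. dist z (c t) < \<rho> / 2" using cK by fastforce
  then obtain z where z: "\<And>t. t \<in> patch T x r \<Longrightarrow> z t \<in> F \<and> dist (z t) (c t) < \<rho> / 2" by metis
  have "inj_on z (patch T x r)"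
  proof (rule inj_onI)
    fix s t assume st: "s \<in> patch T x r" "t \<in> patch T x r" "z s = z t"
    then have "dist (c s) (c t) < \<rho>"
      using z[OF st(1)] z[OF st(2)] dist_triangle_half_r by metis
    then show "s = t" using sep st by (auto simp: patch_def)
  qed
  moreover have "z ` patch T x r \<subseteq> F" using z by blast
  ultimately show ?thesis using F(1) by (meson finite_imageD finite_subset)
qed

lemma tile_minus_eq_imp:
  assumes comp: "compact (fst t)" and ne: "fst t \<noteq> {}" and eq: "tile_minus t v = tile_minus t w"
  shows "v = w"
proof (rule ccontr)
  assume "v \<noteq> w"
  define u where "u = v - w"
  have u: "u \<noteq> 0" using \<open>v \<noteq> w\<close> by (simp add: u_def)
  have img: "(\<lambda>y. y - w) ` fst t = (\<lambda>y. y - v) ` fst t" using eq by (simp add: tile_minus_def)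
  have step: "a + u \<in> fst t" if a: "a \<in> fst t" for a
  proof -
    have "a - w \<in> (\<lambda>y. y - v) ` fst t" using a img by blast
    then obtain b where "b \<in> fst t" "a - w = b - v" by blast
    moreover have "b = a + u" using \<open>a - w = b - v\<close> by (simp add: u_def algebra_simps)
    ultimately show ?thesis by simp
  qed
  have "continuous_on (fst t) (\<lambda>a. a \<bullet> u)" by (intro continuous_intros)
  then obtain a where a: "a \<in> fst t" "\<And>b. b \<in> fst t \<Longrightarrow> b \<bullet> u \<le> a \<bullet> u"
    using continuous_attains_sup[OF comp ne] by blast
  have "(a + u) \<bullet> u \<le> a \<bullet> u" using a step by blast
  then have "u \<bullet> u \<le> 0" by (simp add: inner_add_left)
  moreover have "u \<bullet> u > 0" using u inner_gt_zero_iff by blast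
  ultimately show False by linarith
qed

lemma tile_in_tiling:
  assumes "prototile_collection P" "tiling P T" "t \<in> T"
  shows "compact (fst t)" "fst t \<noteq> {}"
proof -
  obtain p where "p \<in> P" "t \<in> p" using assms by (auto simp: tiling_def)
  then obtain s where s: "is_tile s" "(s, t) \<in> tile_translation"
    using assms(1) unfolding prototile_collection_def quotient_def by blast
  then obtain x where x: "fst t = (\<lambda>y. y - x) ` fst s"
    by (auto simp: tile_translation_def tile_minus_def)
  have "compact (fst s)" "fst s \<noteq> {}"
    using s(1) tile_interior_nonempty[OF s(1)] by (auto simp: is_tile_def)
  then show "compact (fst t)" "fst t \<noteq> {}"
    unfolding x by (auto intro!: compact_continuous_image continuous_intros)
qed

lemma tiling_dist_0_imp_subset:
  assumes P: "prototile_collection P" and T1: "tiling P T1" and T2: "tiling P T2"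
    and D: "tiling_dist T1 T2 = 0"
  shows "T1 \<subseteq> T2"
proof
  fix t assume t: "t \<in> T1"
  note tile = tile_in_tiling[OF P T1 t]
  obtain y where y: "y \<in> fst t" using tile by blast
  define R where "R = norm y"
  have R: "R \<ge> 0" "fst t \<inter> cball 0 R \<noteq> {}" using y by (auto simp: R_def)
  define V where "V = {v. norm v \<le> 2 \<and> tile_minus t v \<in> T2}"
  have "inj_on (tile_minus t) V"
    using tile_minus_eq_imp[OF tile] by (auto simp: inj_on_def)
  moreover have "tile_minus t ` V \<subseteq> patch T2 0 (R + 2)"
    using tile_minus_meets_cball[OF R(2)] by (auto simp: patch_def V_def)
  ultimately have finV: "finite V"
    using finite_patch[OF P T2] by (meson finite_imageD finite_subset)
  have small: "\<exists>v\<in>V. norm v < \<eta>" if "\<eta> > 0" for \<eta>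
  proof -
    define c where "c = Min {\<eta> / 2, 1 / (R + 1), 1 / sqrt 2}"
    have c: "c > 0" "c \<le> \<eta> / 2" "c \<le> 1 / (R + 1)" "c \<le> 1 / sqrt 2"
      using that R by (auto simp: c_def)
    obtain e where e: "0 < e" "e < c" "agree_up_to T1 T2 e"
      using tiling_dist_lessE[OF _ c(4)] D c(1) by metis
    obtain x1 x2 where x: "norm x1 \<le> e" "norm x2 \<le> e"
      "patch (T1 \<ominus> x1) 0 (1 / e) = patch (T2 \<ominus> x2) 0 (1 / e)"
      using e(3) by (auto simp: agree_up_to_def)
    have "1 / sqrt 2 \<le> (1::real)" by simp
    then have e1: "e \<le> 1" using e c by linarith
    have "e \<le> 1 / (R + 1)" using e c by linarith
    then have "e * (R + 1) \<le> 1" using R by (simp add: field_simps)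
    then have "R + 1 \<le> 1 / e" using e(1) by (simp add: field_simps)
    then have "R + norm x1 \<le> 1 / e" using x(1) e1 by linarith
    then have "tile_minus t x1 \<in> patch (T1 \<ominus> x1) 0 (1 / e)"
      using t tile_minus_meets_cball[OF R(2)] by (simp add: patch_def mem_shift_iff)
    then have "tile_minus t (x1 - x2) \<in> T2"
      unfolding x(3) by (simp add: patch_def mem_shift_iff)
    moreover have n: "norm (x1 - x2) \<le> 2 * e"
      using x norm_triangle_ineq4[of x1 x2] by linarith
    ultimately have "x1 - x2 \<in> V" using e1 by (simp add: V_def)
    moreover have "norm (x1 - x2) < \<eta>" using n e c by linarith
    ultimately show ?thesis by blast
  qed
  have "0 \<in> V"
  proof (rule ccontr)
    assume "0 \<notin> V"
    have ne: "V \<noteq> {}" using small[of 1] by auto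
    have "Min (norm ` V) > 0"
      using finV ne \<open>0 \<notin> V\<close> by (subst Min_gr_iff) auto
    then obtain v where "v \<in> V" "norm v < Min (norm ` V)" using small by blast
    then show False using finV by (meson Min_le finite_imageI imageI leD)
  qed
  then show "t \<in> T2" by (simp add: V_def)
qed

lemma agree_up_to_refl: "e > 0 \<Longrightarrow> agree_up_to T T e"
  unfolding agree_up_to_def by (intro exI[of _ 0]) auto

lemma tiling_dist_refl: "tiling_dist T T = 0"
  using tiling_dist_le[OF _ agree_up_to_refl, of _ T] tiling_dist_nonneg[of T T]
  by (meson dense dual_order.strict_iff_not leD order_le_less)

theorem Metric_space_tiling:
  assumes "prototile_collection P"
  shows "Metric_space {T. tiling P T} tiling_dist"
proof
  fix T1 T2 assume "T1 \<in> {T. tiling P T}" "T2 \<in> {T. tiling P T}"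
  then show "tiling_dist T1 T2 = 0 \<longleftrightarrow> T1 = T2"
    using tiling_dist_0_imp_subset[OF assms] tiling_dist_refl tiling_dist_sym
    by (metis mem_Collect_eq subset_antisym)
qed (use tiling_dist_nonneg tiling_dist_sym tiling_dist_triangle in auto)

end

theory Submission
  imports Defs
begin

text \<open>
  The topology of a tiling space resolves orbits from within: two nearby tilings agree on a large
  ball after a small translation, and this translation is unique because two slightly displaced
  copies of a tile overlap (\<open>displacement_unique\<close>). Follow a continuous family of tilings on a
  connected parameter set, all values being close to each other. The small displacements add up
  consistently, and after undoing them the patch around the origin of any prescribed radius is
  locally constant in the parameter. So the whole family lies in a single orbit, with a small
  translation between any two members (\<open>connected_family_same_orbit\<close>).

  Apply this to \<open>x \<mapsto> h (T \<ominus> x)\<close> on small balls. The hull is compact: finite local complexity makes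
  the orbit totally bounded (\<open>orbit_mtotally_bounded\<close>) and the space of tilings is complete
  (\<open>mcomplete_tilings\<close>). Hence \<open>h\<close> is uniformly continuous, and for every \<open>\<eta>\<close> there is one
  \<open>\<delta>\<close>, the same for all tilings of the hull, such that a translation of length at most \<open>\<delta>\<close> in the
  source becomes a translation of length at most \<open>\<eta>\<close> in the target (\<open>local_displacement\<close>).
  Cutting a vector \<open>x\<close> into about \<open>\<bar>x\<bar> / \<delta>\<close> steps shows that \<open>h\<close> maps orbits into orbits, with a
  displacement growing at most linearly in \<open>\<bar>x\<bar>\<close>.

  Only the generating tiling is assumed aperiodic, but repetitivity carries a period of any tiling
  of the hull back to it (\<open>period_of_limit\<close>), so every tiling of the hull is aperiodic. This makes
  the cocycle unique, and then the local estimate says that it is continuous. The inverse of \<open>h\<close>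
  has a continuous cocycle as well; the two cocycles are inverse to each other, which gives the
  homeomorphism and the surjectivity on orbits.
\<close>

section \<open>Patches of tilings\<close>

lemma shift_shift [simp]: "T \<ominus> x \<ominus> y = T \<ominus> (x + y)"
  by (simp add: shift_def image_image)

lemma shift_0 [simp]: "T \<ominus> 0 = T"
  by (simp add: shift_def)

lemma tile_minus_meets_iff:
  "fst (tile_minus t a) \<inter> cball c r \<noteq> {} \<longleftrightarrow> fst t \<inter> cball (c + a) r \<noteq> {}"
proof -
  have "dist c (y - a) = dist (c + a) y" for y
    by (simp add: dist_norm algebra_simps)
  then have "y - a \<in> cball c r \<longleftrightarrow> y \<in> cball (c + a) r" for y
    by simp
  then show ?thesis
    unfolding tile_minus_def fst_conv disjoint_iff by blast
qed

lemma patch_shift: "patch (T \<ominus> a) c r = patch T (c + a) r \<ominus> a"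
proof (rule set_eqI)
  fix t
  have "t \<in> patch (T \<ominus> a) c r \<longleftrightarrow>
      tile_minus t (- a) \<in> T \<and> fst (tile_minus (tile_minus t (- a)) a) \<inter> cball c r \<noteq> {}"
    by (simp add: patch_def mem_shift_iff)
  also have "\<dots> \<longleftrightarrow>
      tile_minus t (- a) \<in> T \<and> fst (tile_minus t (- a)) \<inter> cball (c + a) r \<noteq> {}"
    unfolding tile_minus_meets_iff ..
  also have "\<dots> \<longleftrightarrow> t \<in> patch T (c + a) r \<ominus> a"
    by (simp add: patch_def mem_shift_iff)
  finally show "t \<in> patch (T \<ominus> a) c r \<longleftrightarrow> t \<in> patch T (c + a) r \<ominus> a" .
qed

lemma patch_eq_shift:
  assumes "patch S c r = patch T c r" "c = d + a"
  shows "patch (S \<ominus> a) d r = patch (T \<ominus> a) d r"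
  using assms by (simp add: patch_shift)

lemma patch_eq_subball:
  assumes "patch S c r = patch T c r" "dist c d + r' \<le> r"
  shows "patch S d r' = patch T d r'"
proof -
  have "cball d r' \<subseteq> cball c r"
    using assms(2) by (simp add: cball_subset_cball_iff dist_commute)
  then have "patch S' d r' = {t \<in> patch S' c r. fst t \<inter> cball d r' \<noteq> {}}" for S' :: "('a, 'b) tile set"
    unfolding patch_def by blast
  from this[of S] this[of T] show ?thesis unfolding assms(1) by simp
qed

lemma prototile_translate:
  assumes P: "prototile_collection P" and s: "s \<in> \<Union>P"
  shows "tile_minus s x \<in> \<Union>P"
proof -
  obtain p where p: "p \<in> P" "s \<in> p" using s by blast
  then obtain u where u: "p = tile_translation `` {u}"
    using P unfolding prototile_collection_def quotient_def by blast
  then obtain y where "s = tile_minus u y" using p by (auto simp: tile_translation_def)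
  then have "tile_minus s x = tile_minus u (y + x)" by simp
  then have "tile_minus s x \<in> p"
    unfolding u tile_translation_def by blast
  then show ?thesis using p by blast
qed

lemma tiling_shift:
  assumes P: "prototile_collection P" and T: "tiling P T"
  shows "tiling P (T \<ominus> x)"
  unfolding tiling_def
proof (intro conjI ballI impI)
  show "T \<ominus> x \<subseteq> \<Union>P"
  proof
    fix t assume "t \<in> T \<ominus> x"
    then obtain s where s: "s \<in> T" "t = tile_minus s x" unfolding shift_def by (rule imageE)
    then have "s \<in> \<Union>P" using T unfolding tiling_def by (meson subsetD)
    then show "t \<in> \<Union>P" unfolding s(2) by (rule prototile_translate[OF P])
  qed
  have cover: "(\<Union>t\<in>T. fst t) = UNIV" using T by (simp add: tiling_def)
  show "(\<Union>t\<in>T \<ominus> x. fst t) = UNIV"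
  proof -
    have "y \<in> (\<Union>t\<in>T \<ominus> x. fst t)" for y
    proof -
      obtain t where t: "t \<in> T" "y + x \<in> fst t" using cover by blast
      have "y + x - x \<in> fst (tile_minus t x)"
        unfolding tile_minus_def fst_conv by (rule imageI) (rule t)
      then show ?thesis using t(1) unfolding shift_def by auto
    qed
    then show ?thesis by blast
  qed
  fix s t assume "s \<in> T \<ominus> x" "t \<in> T \<ominus> x" "s \<noteq> t"
  then obtain s' t' where st: "s' \<in> T" "t' \<in> T" "s' \<noteq> t'" "s = tile_minus s' x" "t = tile_minus t' x"
    by (auto simp: shift_def)
  have "fst s \<inter> fst t = (\<lambda>y. y - x) ` (fst s' \<inter> fst t')"
    unfolding st(4,5) tile_minus_def fst_conv by (rule image_Int[symmetric]) simp
  moreover have "interior (fst s' \<inter> fst t') = {}"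
    using T st(1-3) unfolding tiling_def by meson
  ultimately show "interior (fst s \<inter> fst t) = {}"
    by (simp only: interior_translation_subtract image_empty)
qed

lemma tiling_subset: "tiling P T \<Longrightarrow> T \<subseteq> \<Union>P"
  by (simp add: tiling_def)

lemma tiling_overlap:
  "tiling P T \<Longrightarrow> s \<in> T \<Longrightarrow> t \<in> T \<Longrightarrow> interior (fst s \<inter> fst t) \<noteq> {} \<Longrightarrow> s = t"
  unfolding tiling_def by blast

lemma tile_regular:
  assumes "prototile_collection P" "tiling P T" "t \<in> T"
  shows "closure (interior (fst t)) = fst t"
proof -
  obtain p where "p \<in> P" "t \<in> p" using assms by (auto simp: tiling_def)
  then obtain s where s: "is_tile s" "(s, t) \<in> tile_translation"
    using assms(1) unfolding prototile_collection_def quotient_def by blast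
  then obtain x where x: "fst t = (\<lambda>y. y - x) ` fst s"
    by (auto simp: tile_translation_def tile_minus_def)
  have "closure (interior (fst s)) = fst s" 
    using s(1) unfolding is_tile_def by (elim conjE) (rule sym)
  then show ?thesis
    by (simp only: x interior_translation_subtract closure_translation_subtract)
qed

lemma tile_meets_cball:
  assumes "tiling P T" "y \<in> cball x r"
  obtains t where "t \<in> patch T x r" "y \<in> fst t"
proof -
  have "y \<in> (\<Union>t\<in>T. fst t)" using assms(1) by (simp add: tiling_def)
  then obtain t where t: "t \<in> T" "y \<in> fst t" by (rule UN_E)
  then have "t \<in> patch T x r" using assms(2) unfolding patch_def by blast
  then show thesis using that t(2) by blast
qed

lemma interior_finite_Union_empty:
  assumes "finite F" "\<And>S. S \<in> F \<Longrightarrow> closed S \<and> interior S = {}"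
  shows "interior (\<Union>F) = {}"
  using assms
proof (induction F rule: finite_induct)
  case (insert S F)
  then show ?case
    using interior_closed_Un_empty_interior[of S "\<Union>F"] by auto
qed simp

text \<open>
  A tile is the closure of its interior, so a tile that meets the open ball has interior points in
  it, and these form a non-empty open set covered by the finitely many closed tiles of the patch.
  One of the intersections must then have non-empty interior, which two distinct tiles of a tiling
  do not allow. Hence an inclusion of patches is enough to make two tilings agree.
\<close>

lemma tile_in_covering_patch:
  assumes P: "prototile_collection P" and T: "tiling P T" and S: "tiling P S"
    and sub: "patch T x r \<subseteq> S" and t: "t \<in> S" "fst t \<inter> ball x r \<noteq> {}"
  shows "t \<in> patch T x r"
proof -
  define U where "U = interior (fst t) \<inter> ball x r"
  define F where "F = (\<lambda>s. fst s \<inter> fst t) ` patch T x r"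
  have "U \<noteq> {}"
  proof
    assume "U = {}"
    then have "ball x r \<inter> closure (interior (fst t)) = {}"
      using open_Int_closure_eq_empty[OF open_ball] unfolding U_def by (metis Int_commute)
    then show False using t(2) unfolding tile_regular[OF P S t(1)] by (simp add: Int_commute)
  qed
  moreover have "U \<subseteq> interior (\<Union>F)"
  proof (rule interior_maximal)
    show "open U" by (simp add: U_def open_Int)
    show "U \<subseteq> \<Union>F"
    proof
      fix y assume y: "y \<in> U"
      then have "y \<in> cball x r" by (simp add: U_def)
      then obtain s where s: "s \<in> patch T x r" "y \<in> fst s"
        by (rule tile_meets_cball[OF T])
      have "y \<in> fst t" using y interior_subset unfolding U_def by blast
      then show "y \<in> \<Union>F" using s unfolding F_def by blast
    qed
  qed
  ultimately have ne: "interior (\<Union>F) \<noteq> {}" by blast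
  have fin: "finite F"
    unfolding F_def using finite_patch[OF P T] by (rule finite_imageI)
  have closed: "closed A" if A: "A \<in> F" for A
  proof -
    obtain s where s: "s \<in> patch T x r" "A = fst s \<inter> fst t"
      using A unfolding F_def by (rule imageE)
    have "compact (fst s)" "compact (fst t)"
      using tile_in_tiling(1)[OF P S] subsetD[OF sub s(1)] t(1) by simp_all
    then show ?thesis unfolding s(2) by (intro closed_Int compact_imp_closed)
  qed
  have "\<exists>A\<in>F. interior A \<noteq> {}"
  proof (rule ccontr)
    assume no: "\<not> ?thesis"
    have "interior (\<Union>F) = {}"
      by (rule interior_finite_Union_empty[OF fin]) (use closed no in blast)
    then show False using ne by contradiction
  qed
  then obtain A where A: "A \<in> F" "interior A \<noteq> {}" ..
  obtain s where s: "s \<in> patch T x r" "A = fst s \<inter> fst t"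
    using A(1) unfolding F_def by (rule imageE)
  have "s = t"
    by (rule tiling_overlap[OF S subsetD[OF sub s(1)] t(1)]) (use A(2) s(2) in simp)
  then show ?thesis using s(1) by simp
qed

text \<open>
  The radius must shrink: a tile that touches the ball of radius \<open>r\<close> only in its boundary can
  belong to one tiling and not to the other.
\<close>

lemma patch_subset_imp_eq:
  assumes "prototile_collection P" "tiling P T" "tiling P S"
    and sub: "patch T x r \<subseteq> S" and "r' < r"
  shows "patch S x r' = patch T x r'"
proof
  have cball_small: "cball x r' \<subseteq> ball x r" using \<open>r' < r\<close> by auto
  show "patch S x r' \<subseteq> patch T x r'"
  proof
    fix t assume t: "t \<in> patch S x r'"
    then have "fst t \<inter> ball x r \<noteq> {}"
      using cball_small unfolding patch_def by blast
    then have "t \<in> patch T x r"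
      using tile_in_covering_patch[OF assms(1-4)] t by (simp add: patch_def)
    then show "t \<in> patch T x r'" using t by (simp add: patch_def)
  qed
  show "patch T x r' \<subseteq> patch S x r'"
    using sub cball_small ball_subset_cball[of x r] unfolding patch_def by blast
qed

lemma tiling_eqI:
  fixes S T :: "('n::finite, 'l) tile set"
  assumes P: "prototile_collection P" and S: "tiling P S" and T: "tiling P T"
    and eq: "\<And>r. patch S 0 r = patch T 0 r"
  shows "S = T"
proof -
  have sub: "S \<subseteq> T" if S: "tiling P S" and eq: "\<And>r. patch S 0 r = patch T 0 r"
    for S T :: "('n, 'l) tile set"
  proof
    fix t assume t: "t \<in> S"
    then obtain y where "y \<in> fst t" using tile_in_tiling(2)[OF P S t] by blast
    then have "y \<in> fst t \<inter> cball 0 (norm y)" by simp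
    then have "t \<in> patch S 0 (norm y)" using t unfolding patch_def by blast
    then have "t \<in> patch T 0 (norm y)" unfolding eq .
    then show "t \<in> T" by (simp add: patch_def)
  qed
  show ?thesis
    by (rule subset_antisym[OF sub[OF S eq] sub[OF T eq[symmetric]]])
qed

section \<open>Small displacements\<close>

text \<open>
  Every tile contains a ball of a fixed radius \<open>\<rho>\<close>. If a tile around the origin is carried into
  the same tiling by two translations less than \<open>\<rho>\<close> apart, the two copies overlap, hence coincide,
  and a compact set has no translational period. This is what separates the transversal
  direction from the orbit direction: a small displacement between two nearby tilings can be read
  off from any one tile.
\<close>

lemma displacement_unique:
  assumes P: "prototile_collection P"
  obtains \<rho> where "\<rho> > 0"
    "\<And>S S' v w. tiling P S \<Longrightarrow> tiling P S' \<Longrightarrow> patch (S \<ominus> v) 0 0 = patch S' 0 0 \<Longrightarrow>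
       patch (S \<ominus> w) 0 0 = patch S' 0 0 \<Longrightarrow> dist v w < \<rho> \<Longrightarrow> v = w"
proof -
  obtain \<rho> where \<rho>: "\<rho> > 0" and in_ball: "\<And>t. t \<in> \<Union>P \<Longrightarrow> (\<exists>c. ball c \<rho> \<subseteq> fst t)"
    using prototile_uniform[OF P] by metis
  have "v = w" if S: "tiling P S" and S': "tiling P S'"
    and v: "patch (S \<ominus> v) 0 0 = patch S' 0 0" and w: "patch (S \<ominus> w) 0 0 = patch S' 0 0"
    and close: "dist v w < \<rho>" for S S' v w
  proof -
    have "0 \<in> cball (0 :: real ^ 'a) 0" by simp
    then obtain t where "t \<in> patch S' 0 0" by (rule tile_meets_cball[OF S'])
    then have t: "t \<in> S'" and tv: "tile_minus t (- v) \<in> S" and tw: "tile_minus t (- w) \<in> S"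
      using v w by (auto simp: patch_def mem_shift_iff)
    obtain c where c: "ball c \<rho> \<subseteq> fst t" using in_ball[OF subsetD[OF tiling_subset[OF S'] t]] by blast
    have ball: "ball (c + u) \<rho> \<subseteq> fst (tile_minus t (- u))" for u
    proof
      fix y assume "y \<in> ball (c + u) \<rho>"
      then have "y - u \<in> fst t" using c by (auto simp: dist_norm algebra_simps)
      then show "y \<in> fst (tile_minus t (- u))" 
        by (auto simp: tile_minus_def image_iff intro!: bexI[of _ "y - u"])
    qed
    let ?U = "ball (c + v) \<rho> \<inter> ball (c + w) \<rho>"
    have "?U \<subseteq> interior (fst (tile_minus t (- v)) \<inter> fst (tile_minus t (- w)))"
      using ball by (intro interior_maximal) auto
    moreover have "c + v \<in> ?U" using \<rho> close by (simp add: dist_commute)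
    ultimately have "tile_minus t (- v) = tile_minus t (- w)"
      using tiling_overlap[OF S tv tw] by blast
    then show ?thesis
      using tile_minus_eq_imp[OF tile_in_tiling[OF P S' t], of "- v" "- w"] by simp
  qed
  then show ?thesis using that \<rho> by blast
qed

text \<open>
  The two translations in the definition of the distance are combined into one. This costs a
  radius of at most \<open>e\<close>, because the balls are recentred at the origin.
\<close>

lemma close_tilings_displacement:
  assumes "tiling_dist S S' < e" "e \<le> 1 / sqrt 2"
  obtains v where "norm v \<le> 2 * e" "patch (S \<ominus> v) 0 (1 / e - e) = patch S' 0 (1 / e - e)"
proof -
  obtain e0 where e0: "0 < e0" "e0 < e" "agree_up_to S S' e0"
    using tiling_dist_lessE[OF assms] by blast
  then obtain a b where ab: "norm a \<le> e0" "norm b \<le> e0"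
    "patch (S \<ominus> a) 0 (1 / e0) = patch (S' \<ominus> b) 0 (1 / e0)"
    by (auto simp: agree_up_to_def)
  have "patch (S \<ominus> a \<ominus> - b) b (1 / e0) = patch (S' \<ominus> b \<ominus> - b) b (1 / e0)"
    by (rule patch_eq_shift[OF ab(3)]) simp
  then have "patch (S \<ominus> (a - b)) b (1 / e0) = patch S' b (1 / e0)" by simp
  moreover have "dist b 0 + (1 / e - e) \<le> 1 / e0"
  proof -
    have "1 / e \<le> 1 / e0" using e0 by (simp add: frac_le)
    then show ?thesis using ab e0 by simp
  qed
  ultimately have "patch (S \<ominus> (a - b)) 0 (1 / e - e) = patch S' 0 (1 / e - e)"
    by (rule patch_eq_subball)
  moreover have "norm (a - b) \<le> 2 * e"
    using norm_triangle_ineq4[of a b] ab e0 by linarith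
  ultimately show ?thesis using that by blast
qed

lemma le_half_imp_le_dist_bound: "e \<le> 1 / 2 \<Longrightarrow> e \<le> 1 / sqrt (2::real)"
proof -
  have "1 / 2 \<le> 1 / sqrt (2::real)"
    using real_sqrt_le_mono[of 2 4] by (simp add: field_simps)
  then show "e \<le> 1 / 2 \<Longrightarrow> e \<le> 1 / sqrt 2" by linarith
qed

lemma displaced_tilings_close:
  assumes "e > 0" "norm v \<le> e" "patch (S \<ominus> v) 0 (1 / e) = patch S' 0 (1 / e)"
  shows "tiling_dist S S' \<le> e"
proof (rule tiling_dist_le)
  show "agree_up_to S S' e"
    unfolding agree_up_to_def using assms by (intro exI[of _ v] exI[of _ 0]) simp
qed fact

lemma tiling_dist_shift_le: "tiling_dist (T \<ominus> x) (T \<ominus> y) \<le> norm (x - y)"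
proof (cases "x = y")
  case False
  then show ?thesis
    by (intro displaced_tilings_close[of _ "y - x"]) (auto simp: norm_minus_commute)
qed (simp add: tiling_dist_refl)

section \<open>Rigidity of connected families of tilings\<close>

text \<open>
  A connected family of small diameter cannot leave an orbit. Let \<open>g t\<close> be the unique small
  displacement from \<open>\<phi> x\<close> to \<open>\<phi> t\<close>. For \<open>t\<close> close to \<open>s\<close> the tilings \<open>\<phi> s\<close> and \<open>\<phi> t\<close>
  agree, up to a displacement \<open>v\<close>, on a ball as large as desired; uniqueness gives
  \<open>g t = g s + v\<close>. So the patch of radius \<open>R\<close> of \<open>\<phi> t\<close> translated back by \<open>g t\<close> is locally
  constant in \<open>t\<close>, hence constant, for every \<open>R\<close>. The hypothesis on \<open>\<rho>\<close> is the uniqueness of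
  small displacements, which fixes the admissible scale \<open>e\<close>; the scale \<open>e'\<close> used locally
  depends on \<open>R\<close>, while \<open>g\<close> does not.
\<close>

lemma connected_family_same_orbit:
  fixes P :: "('n::finite, 'l) tile set set" and X :: "'a::metric_space set"
  assumes P: "prototile_collection P"
    and uniq: "\<And>S S' v w. tiling P S \<Longrightarrow> tiling P S' \<Longrightarrow> patch (S \<ominus> v) 0 0 = patch S' 0 0 \<Longrightarrow>
       patch (S \<ominus> w) 0 0 = patch S' 0 0 \<Longrightarrow> dist v w < \<rho> \<Longrightarrow> v = w"
    and X: "connected X" and til: "\<And>s. s \<in> X \<Longrightarrow> tiling P (\<phi> s)"
    and cont: "\<And>s e'. s \<in> X \<Longrightarrow> e' > 0 \<Longrightarrow>
      \<exists>d>0. \<forall>t\<in>X. dist s t < d \<longrightarrow> tiling_dist (\<phi> s) (\<phi> t) < e'"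
    and e: "0 < e" "e \<le> 1 / 4" "6 * e < \<rho>"
    and small: "\<And>s t. s \<in> X \<Longrightarrow> t \<in> X \<Longrightarrow> tiling_dist (\<phi> s) (\<phi> t) < e"
    and xy: "x \<in> X" "y \<in> X"
  shows "\<exists>w. norm w \<le> 4 * e \<and> \<phi> y = \<phi> x \<ominus> w"
proof -
  have e_sqrt: "e \<le> 1 / sqrt 2" using e(2) by (intro le_half_imp_le_dist_bound) simp
  have rad_ge: "R + 1 \<le> 1 / e' - e'" if e': "0 < e'" "e' \<le> 1 / (R + 2)" "R \<ge> 0" for e' R :: real
  proof -
    have "R + 2 \<le> 1 / e'" using e' by (simp add: field_simps)
    moreover have "e' \<le> 1" using e' by (simp add: divide_le_eq_1 order_trans[OF e'(2)])
    ultimately show ?thesis by linarith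
  qed
  have rad_e: "1 / e - e \<ge> 3"
  proof -
    have "4 \<le> 1 / e" using e by (simp add: field_simps)
    then show ?thesis using e by linarith
  qed
  define g where "g t = (SOME v. norm v \<le> 2 * e \<and>
    patch (\<phi> x \<ominus> v) 0 (1 / e - e) = patch (\<phi> t) 0 (1 / e - e))" for t
  have g: "norm (g t) \<le> 2 * e \<and>
    patch (\<phi> x \<ominus> g t) 0 (1 / e - e) = patch (\<phi> t) 0 (1 / e - e)" if t: "t \<in> X" for t
  proof -
    obtain v where "norm v \<le> 2 * e" "patch (\<phi> x \<ominus> v) 0 (1 / e - e) = patch (\<phi> t) 0 (1 / e - e)"
      using close_tilings_displacement[OF small[OF xy(1) t] e_sqrt] by metis
    then show ?thesis
      unfolding g_def by (intro someI[where P = "\<lambda>v. norm v \<le> 2 * e \<and> _ v"]) simp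
  qed
  have const: "patch (\<phi> y \<ominus> - g y) 0 R = patch (\<phi> x \<ominus> - g x) 0 R" if R: "R \<ge> 0" for R
  proof (rule connected_local_const[OF X xy(2,1)], intro ballI)
    fix s assume s: "s \<in> X"
    define e' where "e' = min e (1 / (R + 2))"
    have e': "e' > 0" "e' \<le> e" "e' \<le> 1 / (R + 2)" using e R by (auto simp: e'_def)
    obtain d where d: "d > 0" "\<And>t. t \<in> X \<Longrightarrow> dist s t < d \<Longrightarrow> tiling_dist (\<phi> s) (\<phi> t) < e'"
      using cont[OF s e'(1)] by blast
    have "patch (\<phi> s \<ominus> - g s) 0 R = patch (\<phi> t \<ominus> - g t) 0 R"
      if t: "t \<in> X" and st: "dist s t < d" for t
    proof -
      let ?r = "1 / e' - e'"
      have r: "R + 1 \<le> ?r" using rad_ge e' R by blast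
      have e'2: "e' \<le> 1 / sqrt 2" using e' e_sqrt by linarith
      obtain v where v: "norm v \<le> 2 * e'" "patch (\<phi> s \<ominus> v) 0 ?r = patch (\<phi> t) 0 ?r"
        using close_tilings_displacement[OF d(2)[OF t st] e'2] by metis
      have norms: "norm v \<le> 1" "norm (g t) \<le> 1" using v g[OF t] e' e by linarith+
      have "patch (\<phi> x \<ominus> g s \<ominus> v) (- v) (1 / e - e) = patch (\<phi> s \<ominus> v) (- v) (1 / e - e)"
        using g[OF s] by (intro patch_eq_shift[of _ 0]) auto
      then have "patch (\<phi> x \<ominus> g s \<ominus> v) 0 0 = patch (\<phi> s \<ominus> v) 0 0"
        by (rule patch_eq_subball) (use norms rad_e in simp)
      also have "\<dots> = patch (\<phi> t) 0 0"
        using v(2) by (rule patch_eq_subball) (use r R in simp)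
      finally have 1: "patch (\<phi> x \<ominus> (g s + v)) 0 0 = patch (\<phi> t) 0 0" by simp
      have 2: "patch (\<phi> x \<ominus> g t) 0 0 = patch (\<phi> t) 0 0"
        using conjunct2[OF g[OF t]] by (rule patch_eq_subball) (use rad_e in simp)
      have "dist (g s + v) (g t) \<le> norm (g s) + norm v + norm (g t)"
        unfolding dist_norm by norm
      also have "\<dots> < \<rho>" using g[OF s] g[OF t] v e' e by linarith
      finally have gt: "g s + v = g t"
        by (rule uniq[OF til[OF xy(1)] til[OF t] 1 2])
      have "patch (\<phi> s \<ominus> v \<ominus> - g t) (g t) ?r = patch (\<phi> t \<ominus> - g t) (g t) ?r"
        using v(2) by (rule patch_eq_shift) simp
      then have "patch (\<phi> s \<ominus> v \<ominus> - g t) 0 R = patch (\<phi> t \<ominus> - g t) 0 R"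
        by (rule patch_eq_subball) (use norms r in simp)
      then show ?thesis by (simp add: gt[symmetric])
    qed
    then show "\<forall>\<^sub>F t in at s within X. patch (\<phi> s \<ominus> - g s) 0 R = patch (\<phi> t \<ominus> - g t) 0 R"
      unfolding eventually_at using d(1) by (metis dist_commute)
  qed
  have const': "patch (\<phi> y \<ominus> - g y) 0 R = patch (\<phi> x \<ominus> - g x) 0 R" for R
  proof (cases "R \<ge> 0")
    case False
    then have "cball 0 R = ({} :: (real ^ 'n) set)" by simp
    then show ?thesis by (simp add: patch_def)
  qed (rule const)
  have "\<phi> y \<ominus> - g y = \<phi> x \<ominus> - g x"
    by (rule tiling_eqI[OF P tiling_shift[OF P til[OF xy(2)]] tiling_shift[OF P til[OF xy(1)]] const'])
  then have "\<phi> y \<ominus> - g y \<ominus> g y = \<phi> x \<ominus> - g x \<ominus> g y" by simp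
  then have "\<phi> y = \<phi> x \<ominus> (g y - g x)" by simp
  moreover have "norm (g y - g x) \<le> 4 * e"
    using norm_triangle_ineq4[of "g y" "g x"] g[OF xy(1)] g[OF xy(2)] by linarith
  ultimately show ?thesis by blast
qed

section \<open>Compactness of the tiling space\<close>

text \<open>
  The radii exhaust the space, so the tiles that persist form a tiling: any point, and any pair of
  tiles, is already seen in a single \<open>S n\<close>.
\<close>

lemma limit_tiling:
  fixes S :: "nat \<Rightarrow> ('n::finite, 'l) tile set"
  assumes S: "\<And>n. tiling P (S n)"
    and step: "\<And>n. patch (S n) 0 (real n) = patch (S (Suc n)) 0 (real n)"
  obtains L where "tiling P L" "\<And>n. patch L 0 (real n) = patch (S n) 0 (real n)"
proof -
  have stable: "patch (S n) 0 (real n) = patch (S m) 0 (real n)" if "n \<le> m" for n m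
    using that
  proof (induction m rule: dec_induct)
    case (step m)
    have "patch (S m) 0 (real n) = patch (S (Suc m)) 0 (real n)"
      using assms(2) by (rule patch_eq_subball) (use step in simp)
    then show ?case using step by simp
  qed simp
  define L where "L = (\<Union>n. patch (S n) 0 (real n))"
  have L_eq: "patch L 0 (real n) = patch (S n) 0 (real n)" for n
  proof
    show "patch (S n) 0 (real n) \<subseteq> patch L 0 (real n)"
      unfolding L_def patch_def by blast
    show "patch L 0 (real n) \<subseteq> patch (S n) 0 (real n)"
    proof
      fix t assume t: "t \<in> patch L 0 (real n)"
      then obtain m where "t \<in> patch (S m) 0 (real m)" unfolding L_def patch_def by blast
      then have "t \<in> patch (S (max m n)) 0 (real m)" using stable[of m "max m n"] by simp
      then have "t \<in> patch (S (max m n)) 0 (real n)" using t by (simp add: patch_def)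
      then show "t \<in> patch (S n) 0 (real n)" using stable[of n "max m n"] by simp
    qed
  qed
  have pair: "\<exists>n. s \<in> S n \<and> t \<in> S n" if st: "s \<in> L" "t \<in> L" for s t
  proof -
    obtain m k where mk: "s \<in> patch (S m) 0 (real m)" "t \<in> patch (S k) 0 (real k)"
      using st unfolding L_def by blast
    then have "s \<in> patch (S (max m k)) 0 (real m)" "t \<in> patch (S (max m k)) 0 (real k)"
      using stable[of m "max m k"] stable[of k "max m k"] by simp_all
    then show ?thesis by (auto simp: patch_def)
  qed
  have "tiling P L"
    unfolding tiling_def
  proof (intro conjI ballI impI)
    show "L \<subseteq> \<Union>P"
    proof
      fix t assume "t \<in> L"
      then obtain n where "t \<in> S n" using pair by blast
      then show "t \<in> \<Union>P" using tiling_subset[OF S] by (rule subsetD[rotated])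
    qed
    have cover: "y \<in> (\<Union>t\<in>L. fst t)" for y
    proof -
      obtain n where "norm y \<le> real n" using real_arch_simple by blast
      then have "y \<in> cball 0 (real n)" by simp
      then obtain t where "t \<in> patch (S n) 0 (real n)" "y \<in> fst t"
        by (rule tile_meets_cball[OF S])
      moreover from this(1) have "t \<in> L" unfolding L_def by blast
      ultimately show ?thesis by blast
    qed
    show "(\<Union>t\<in>L. fst t) = UNIV" using cover by (rule UNIV_eq_I[symmetric])
    fix s t assume st: "s \<in> L" "t \<in> L" "s \<noteq> t"
    obtain n where n: "s \<in> S n" "t \<in> S n" using pair[OF st(1,2)] by blast
    show "interior (fst s \<inter> fst t) = {}"
      using tiling_overlap[OF S n] st(3) by (rule contrapos_np[rotated])
  qed
  then show ?thesis using that L_eq by blast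
qed

lemma fast_Cauchy_subsequence:
  assumes "Metric_space.MCauchy M d \<sigma>" "Metric_space M d"
  obtains r :: "nat \<Rightarrow> nat" where "strict_mono r"
    "\<And>n. d (\<sigma> (r n)) (\<sigma> (r (Suc n))) < (1 / 2) ^ (n + 2)"
proof -
  have "\<exists>N. \<forall>n n'. N \<le> n \<longrightarrow> N \<le> n' \<longrightarrow> d (\<sigma> n) (\<sigma> n') < (1 / 2) ^ (k + 2)" for k
  proof -
    have "(1 / 2 :: real) ^ (k + 2) > 0" by simp
    then show ?thesis using assms(1) unfolding Metric_space.MCauchy_def[OF assms(2)] by blast
  qed
  then obtain N where N: "\<And>k n n'. N k \<le> n \<Longrightarrow> N k \<le> n' \<Longrightarrow> d (\<sigma> n) (\<sigma> n') < (1 / 2) ^ (k + 2)"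
    by metis
  have "\<exists>r. \<forall>n. N n \<le> r n \<and> r n < r (Suc n)"
  proof (rule dependent_nat_choice)
    fix x n show "\<exists>y. N (Suc n) \<le> y \<and> x < y"
      by (intro exI[of _ "max (N (Suc n)) (Suc x)"]) simp
  qed blast
  then obtain r where r: "\<And>n. N n \<le> r n" "\<And>n. r n < r (Suc n)" by blast
  have *: "d (\<sigma> (r n)) (\<sigma> (r (Suc n))) < (1 / 2) ^ (n + 2)" for n
    using r(1)[of n] r(2)[of n] by (intro N) simp_all
  have "strict_mono r" using r(2) by (simp add: strict_mono_Suc_iff)
  from that[OF this *] show ?thesis .
qed

text \<open>
  Along a fast Cauchy sequence consecutive tilings agree on balls of exponentially growing radius up
  to displacements \<open>v n\<close> that are summable. Translating the \<open>n\<close>-th tiling by the tail \<open>q n\<close> of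
  the series turns this into exact agreement of consecutive tilings, and the tails tend to zero.
\<close>

lemma mcomplete_tilings:
  fixes P :: "('n::finite, 'l) tile set set"
  assumes P: "prototile_collection P"
  shows "Metric_space.mcomplete {T. tiling P T} tiling_dist"
proof -
  interpret Metric_space "{T. tiling P T}" tiling_dist
    by (rule Metric_space_tiling[OF P])
  show ?thesis
    unfolding mcomplete_def
  proof (intro allI impI)
    fix \<sigma> assume \<sigma>: "MCauchy \<sigma>"
    obtain r where r: "strict_mono r"
      "\<And>n. tiling_dist (\<sigma> (r n)) (\<sigma> (r (Suc n))) < (1 / 2) ^ (n + 2)"
      using fast_Cauchy_subsequence[OF \<sigma> Metric_space_axioms] by blast
    define \<tau> where "\<tau> n = \<sigma> (r n)" for n
    have \<tau>: "tiling P (\<tau> n)" for n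
      using \<sigma> unfolding MCauchy_def \<tau>_def by blast
    \<comment> \<open>The exponent makes the radius \<open>1 / e n - e n\<close> exceed \<open>n\<close> by more than the bound 2 on the tails.\<close>
    define e where "e n = (1 / 2 :: real) ^ (n + 2)" for n
    have e: "e n > 0" "e n \<le> 1 / 2" for n
      using power_le_one[of "1 / 2 :: real" n] by (auto simp: e_def)
    have "\<exists>v. norm v \<le> 2 * e n \<and> patch (\<tau> n \<ominus> v) 0 (1 / e n - e n) = patch (\<tau> (Suc n)) 0 (1 / e n - e n)" for n
    proof (rule close_tilings_displacement)
      show "tiling_dist (\<tau> n) (\<tau> (Suc n)) < e n" using r(2) by (simp add: \<tau>_def e_def)
      show "e n \<le> 1 / sqrt 2" using e(2) by (rule le_half_imp_le_dist_bound)
    qed blast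
    then obtain v where v: "\<And>n. norm (v n) \<le> 2 * e n"
      "\<And>n. patch (\<tau> n \<ominus> v n) 0 (1 / e n - e n) = patch (\<tau> (Suc n)) 0 (1 / e n - e n)"
      by metis
    have v_le: "norm (v n) \<le> (1 / 2) ^ n" for n
    proof -
      have "2 * e n \<le> (1 / 2) ^ n" by (simp add: e_def)
      then show ?thesis using v(1)[of n] by linarith
    qed
    have geo: "summable (\<lambda>n. (1 / 2 :: real) ^ n)" by (rule summable_geometric) simp
    have sum_nv: "summable (\<lambda>n. norm (v (n + k)))" for k
    proof -
      have "summable (\<lambda>n. norm (v n))"
        by (rule summable_comparison_test[OF _ geo]) (use v_le in auto)
      then show ?thesis by (subst summable_iff_shift)
    qed
    define q where "q n = (\<Sum>k. v (k + n))" for n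
    have q_step: "q n = v n + q (Suc n)" for n
    proof -
      have "summable (\<lambda>k. v (k + n))" by (rule summable_norm_cancel[OF sum_nv])
      from suminf_split_head[OF this] show ?thesis by (simp add: q_def)
    qed
    have q_le: "norm (q n) \<le> 2" for n
    proof -
      have "norm (q n) \<le> (\<Sum>k. norm (v (k + n)))"
        unfolding q_def by (rule summable_norm[OF sum_nv])
      also have "\<dots> \<le> (\<Sum>k. (1 / 2) ^ k)"
      proof (rule suminf_le[OF _ sum_nv geo])
        fix k show "norm (v (k + n)) \<le> (1 / 2) ^ k"
          by (rule order_trans[OF v_le power_decreasing]) simp_all
      qed
      also have "\<dots> = 2" by (subst suminf_geometric) auto
      finally show ?thesis .
    qed
    have q_lim: "q \<longlonglongrightarrow> 0"
    proof -
      have "summable v" using summable_norm_cancel[OF sum_nv[of 0]] by simp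
      then show ?thesis unfolding q_def by (rule suminf_exist_split2)
    qed
    define S where "S n = \<tau> n \<ominus> q n" for n
    have S: "tiling P (S n)" for n unfolding S_def by (rule tiling_shift[OF P \<tau>])
    have "patch (S n) 0 (real n) = patch (S (Suc n)) 0 (real n)" for n
    proof -
      have "patch (\<tau> n \<ominus> v n \<ominus> q (Suc n)) (- q (Suc n)) (1 / e n - e n) =
          patch (\<tau> (Suc n) \<ominus> q (Suc n)) (- q (Suc n)) (1 / e n - e n)"
        using v(2) by (rule patch_eq_shift) simp
      then have "patch (\<tau> n \<ominus> v n \<ominus> q (Suc n)) 0 (real n) = patch (S (Suc n)) 0 (real n)"
        unfolding S_def
      proof (rule patch_eq_subball)
        have "real n + 4 \<le> 2 ^ (n + 2)"
          by (induction n) auto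
        then have "real n + 4 \<le> 1 / e n" by (simp add: e_def power_divide)
        then show "dist (- q (Suc n)) 0 + (real n) \<le> 1 / e n - e n"
          using e[of n] q_le[of "Suc n"] by simp
      qed
      then show ?thesis by (simp add: S_def q_step[of n])
    qed
    then obtain L where L: "tiling P L" "\<And>n. patch L 0 (real n) = patch (S n) 0 (real n)"
      using limit_tiling[of P S] S by metis
    have "limitin mtopology (\<sigma> \<circ> r) L sequentially"
      unfolding limitin_metric
    proof (intro conjI allI impI)
      show "L \<in> {T. tiling P T}" using L by simp
      fix \<epsilon> :: real assume \<epsilon>: "\<epsilon> > 0"
      have "\<forall>\<^sub>F n in sequentially. norm (q n) < \<epsilon> / 2"
        using q_lim \<epsilon> by (auto simp: tendsto_iff dest!: spec[of _ "\<epsilon> / 2"])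
      moreover have "\<forall>\<^sub>F n in sequentially. real n \<ge> 2 / \<epsilon>"
        using filterlim_real_sequentially by (simp add: filterlim_at_top)
      ultimately show "\<forall>\<^sub>F n in sequentially. (\<sigma> \<circ> r) n \<in> {T. tiling P T} \<and>
          tiling_dist ((\<sigma> \<circ> r) n) L < \<epsilon>"
      proof eventually_elim
        case (elim n)
        have "patch (\<tau> n \<ominus> q n) 0 (1 / (\<epsilon> / 2)) = patch L 0 (1 / (\<epsilon> / 2))"
          using L(2)[of n, symmetric] unfolding S_def by (rule patch_eq_subball) (use elim in simp)
        then have "tiling_dist (\<tau> n) L \<le> \<epsilon> / 2"
          using \<epsilon> elim by (intro displaced_tilings_close) auto
        then show ?case using \<tau>[of n] \<epsilon> by (simp add: \<tau>_def)
      qed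
    qed
    then show "\<exists>L. limitin mtopology \<sigma> L sequentially"
      using MCauchy_convergent_subsequence[OF \<sigma> r(1)] by blast
  qed
qed

text \<open>
  Finite local complexity leaves finitely many central patches up to translation. The translation
  matching two central patches is not under control a priori, but its length is bounded since both
  patches cover the origin and stay near the ball of radius \<open>R\<close>. A finite net of a ball therefore
  takes care of it.
\<close>

lemma orbit_mtotally_bounded:
  fixes P :: "('n::finite, 'l) tile set set"
  assumes P: "prototile_collection P" and T: "tiling P T" and FLC: "finite_local_complexity T"
  shows "Metric_space.mtotally_bounded {T. tiling P T} tiling_dist (orbit T)"
proof -
  interpret Metric_space "{T. tiling P T}" tiling_dist
    by (rule Metric_space_tiling[OF P])
  note Tx = tiling_shift[OF P T]
  obtain \<delta> where diam: "\<And>t a b. t \<in> \<Union>P \<Longrightarrow> a \<in> fst t \<Longrightarrow> b \<in> fst t \<Longrightarrow> dist a b \<le> \<delta>"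
    using prototile_uniform[OF P] by metis
  show ?thesis
    unfolding mtotally_bounded_def
  proof (intro allI impI)
    fix \<epsilon> :: real assume \<epsilon>: "\<epsilon> > 0"
    define e where "e = \<epsilon> / 2"
    have e: "e > 0" using \<epsilon> by (simp add: e_def)
    define R where "R = 1 / e + 1"
    have R: "R > 0" "1 / e < R" using e by (auto simp: R_def add_pos_pos)
    define c where "c x = patch_translation `` {patch T x R}" for x
    have "range (\<lambda>x. patch T x R) // patch_translation = range c"
      by (auto simp: quotient_def c_def)
    then have "finite (range c)"
      using FLC R(1) unfolding finite_local_complexity_def by metis
    then obtain F where F: "finite F" "range c = c ` F"
      using finite_subset_image[of "range c" c UNIV] by blast
    have rep: "\<exists>i\<in>F. \<exists>z. norm z \<le> R + \<delta> \<and> tiling_dist (T \<ominus> x) (T \<ominus> (i + z)) \<le> e" for x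
    proof -
      obtain i where i: "i \<in> F" "c x = c i" using F(2) by blast
      have "(patch T x R, patch T x R) \<in> patch_translation"
        unfolding patch_translation_def by (auto intro!: exI[of _ 0])
      then have "patch T x R \<in> c x" unfolding c_def by blast
      then have "patch T x R \<in> c i" unfolding i(2) .
      then obtain y where y: "patch T x R = patch T i R \<ominus> y"
        unfolding c_def patch_translation_def by blast
      \<comment> \<open>The displacement seen from the origin, after both centres are moved there.\<close>
      define z where "z = y + x - i"
      have eq: "patch (T \<ominus> x) 0 R = patch (T \<ominus> i) 0 R \<ominus> z"
        by (simp add: patch_shift y z_def)
      have "0 \<in> cball (0 :: real ^ 'n) R" using R by simp
      then obtain t where t: "t \<in> patch (T \<ominus> x) 0 R" "0 \<in> fst t"
        by (rule tile_meets_cball[OF Tx])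
      define t' where "t' = tile_minus t (- z)"
      have t': "t' \<in> patch (T \<ominus> i) 0 R"
        using t(1) unfolding eq mem_shift_iff t'_def .
      then obtain p where p: "p \<in> fst t'" "norm p \<le> R" by (auto simp: patch_def)
      have "0 - (- z) \<in> fst t'"
        unfolding t'_def tile_minus_def fst_conv by (rule imageI[OF t(2)])
      then have "z \<in> fst t'" by simp
      moreover have "t' \<in> \<Union>P"
        using t' tiling_subset[OF Tx[of i]] unfolding patch_def by blast
      ultimately have "dist z p \<le> \<delta>" using diam p(1) by blast
      then have "norm z \<le> R + \<delta>"
        using p(2) norm_triangle_sub[of z p] by (simp add: dist_norm)
      moreover have "patch (T \<ominus> (i + z)) 0 (1 / e) = patch (T \<ominus> x) 0 (1 / e)"
      proof (rule patch_subset_imp_eq[OF P Tx Tx _ R(2)])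
        show "patch (T \<ominus> x) 0 R \<subseteq> T \<ominus> (i + z)"
          unfolding eq by (auto simp: patch_def mem_shift_iff algebra_simps)
      qed
      then have "tiling_dist (T \<ominus> x) (T \<ominus> (i + z)) \<le> e"
        using e by (intro displaced_tilings_close[of _ 0]) auto
      ultimately show ?thesis using i(1) by blast
    qed
    have "compact (cball (0 :: real ^ 'n) (R + \<delta>))" by simp
    then obtain N where N: "finite N" "cball (0 :: real ^ 'n) (R + \<delta>) \<subseteq> (\<Union>z\<in>N. ball z e)"
      using e unfolding compact_eq_totally_bounded by blast
    define K where "K = (\<lambda>(i, z). T \<ominus> (i + z)) ` (F \<times> N)"
    show "\<exists>K. finite K \<and> K \<subseteq> orbit T \<and> orbit T \<subseteq> (\<Union>S\<in>K. mball S \<epsilon>)"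
    proof (intro exI[of _ K] conjI subsetI)
      show "finite K" using F(1) N(1) by (simp add: K_def)
      show "S \<in> orbit T" if "S \<in> K" for S using that by (auto simp: K_def orbit_def)
      fix S assume "S \<in> orbit T"
      then obtain x where x: "S = T \<ominus> x" unfolding orbit_def by blast
      obtain i z where iz: "i \<in> F" "norm z \<le> R + \<delta>" "tiling_dist (T \<ominus> x) (T \<ominus> (i + z)) \<le> e"
        using rep by blast
      have "z \<in> cball 0 (R + \<delta>)" using iz(2) by simp
      then obtain w where w: "w \<in> N" "dist w z < e" using N(2) by auto
      have "tiling_dist (T \<ominus> (i + z)) (T \<ominus> (i + w)) \<le> norm (i + z - (i + w))"
        by (rule tiling_dist_shift_le)
      also have "\<dots> < e" using w(2) by (simp add: dist_norm norm_minus_commute)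
      finally have "tiling_dist (T \<ominus> x) (T \<ominus> (i + w)) < \<epsilon>"
        using tiling_dist_triangle[of "T \<ominus> x" "T \<ominus> (i + w)" "T \<ominus> (i + z)"] iz(3)
        by (simp add: e_def)
      then have "S \<in> mball (T \<ominus> (i + w)) \<epsilon>"
        using Tx by (simp add: x tiling_dist_sym)
      moreover have "T \<ominus> (i + w) \<in> K" using iz(1) w(1) unfolding K_def by blast
      ultimately show "S \<in> (\<Union>S\<in>K. mball S \<epsilon>)" by blast
    qed
  qed
qed

lemma compactin_tiling_space:
  assumes P: "prototile_collection P" and T: "tiling P T" and FLC: "finite_local_complexity T"
  shows "compactin (tiling_topology P) (tiling_space P T)"
proof -
  interpret Metric_space "{T. tiling P T}" tiling_dist
    by (rule Metric_space_tiling[OF P])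
  show ?thesis
    using mtotally_bounded_eq_compact_closure_of[OF mcomplete_tilings[OF P]]
      orbit_mtotally_bounded[OF P T FLC]
    unfolding tiling_topology_def tiling_space_def by blast
qed

section \<open>Translation invariance and aperiodicity of the hull\<close>

lemma mem_tiling_space_iff:
  assumes P: "prototile_collection P" and T: "tiling P T"
  shows "S \<in> tiling_space P T \<longleftrightarrow> tiling P S \<and> (\<forall>r>0. \<exists>x. tiling_dist S (T \<ominus> x) < r)"
proof -
  interpret Metric_space "{T. tiling P T}" tiling_dist
    by (rule Metric_space_tiling[OF P])
  show ?thesis
    using tiling_shift[OF P T]
    by (auto simp: tiling_space_def tiling_topology_def metric_closure_of orbit_def)
qed

lemma tiling_dist_shift_continuous:
  fixes x :: "real ^ 'n::finite"
  assumes e: "e > 0"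
  obtains c where "c > 0"
    "\<And>S S' :: ('n, 'l) tile set. tiling_dist S S' < c \<Longrightarrow> tiling_dist (S \<ominus> x) (S' \<ominus> x) < e"
proof -
  define a where "a = e / 2"
  have a: "a > 0" "a < e" using e by (auto simp: a_def)
  define b where "b = norm x + 1 / a + 1"
  have b: "b > 1" using a by (simp add: b_def add_nonneg_pos)
  define c where "c = Min {1 / 2, a / 2, 1 / b}"
  have c: "c > 0" "c \<le> 1 / 2" "2 * c \<le> a" "c \<le> 1 / b" using a b by (auto simp: c_def)
  have "b \<le> 1 / c" using c b by (simp add: field_simps)
  then have rad: "norm x + 1 / a \<le> 1 / c - c" using c(2) by (simp add: b_def)
  have "tiling_dist (S \<ominus> x) (S' \<ominus> x) < e" if D: "tiling_dist S S' < c"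
    for S S' :: "('n, 'l) tile set"
  proof -
    have "c \<le> 1 / sqrt 2" using c(2) by (rule le_half_imp_le_dist_bound)
    then obtain v where v: "norm v \<le> 2 * c"
      "patch (S \<ominus> v) 0 (1 / c - c) = patch S' 0 (1 / c - c)"
      using close_tilings_displacement[OF D] by metis
    have "patch (S \<ominus> v \<ominus> x) (- x) (1 / c - c) = patch (S' \<ominus> x) (- x) (1 / c - c)"
      using v(2) by (rule patch_eq_shift) simp
    then have "patch (S \<ominus> v \<ominus> x) 0 (1 / a) = patch (S' \<ominus> x) 0 (1 / a)"
      by (rule patch_eq_subball) (use rad in simp)
    then have "patch (S \<ominus> x \<ominus> v) 0 (1 / a) = patch (S' \<ominus> x) 0 (1 / a)"
      by (simp add: add.commute)
    then have "tiling_dist (S \<ominus> x) (S' \<ominus> x) \<le> a"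
      using a v(1) c by (intro displaced_tilings_close) auto
    then show ?thesis using a by linarith
  qed
  then show ?thesis using that c(1) by blast
qed

lemma tiling_space_shift:
  assumes P: "prototile_collection P" and T: "tiling P T" and S: "S \<in> tiling_space P T"
  shows "S \<ominus> x \<in> tiling_space P T"
proof -
  have "\<exists>y. tiling_dist (S \<ominus> x) (T \<ominus> y) < r" if r: "r > 0" for r
  proof -
    obtain c where c: "c > 0"
      "\<And>S'. tiling_dist S S' < c \<Longrightarrow> tiling_dist (S \<ominus> x) (S' \<ominus> x) < r"
      using tiling_dist_shift_continuous[OF r] by metis
    obtain y where "tiling_dist S (T \<ominus> y) < c"
      using S c(1) unfolding mem_tiling_space_iff[OF P T] by blast
    then have "tiling_dist (S \<ominus> x) (T \<ominus> (y + x)) < r" using c(2) by fastforce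
    then show ?thesis by blast
  qed
  moreover have "tiling P (S \<ominus> x)"
    using S tiling_shift[OF P] unfolding mem_tiling_space_iff[OF P T] by blast
  ultimately show ?thesis unfolding mem_tiling_space_iff[OF P T] by blast
qed

text \<open>
  Repetitivity passes to limits because it bounds the distance to the next copy of a patch
  uniformly: a limit tiling looks like a translate of \<open>T\<close> on a ball large enough to contain one.
\<close>

lemma patch_recurs_in_tiling_space:
  assumes P: "prototile_collection P" and T: "tiling P T" and rep: "repetitive T"
    and S: "S \<in> tiling_space P T"
  obtains w where "patch T 0 r \<ominus> w \<subseteq> S"
proof -
  have "patch T 0 r \<subseteq> T \<and> finite (patch T 0 r)"
    using finite_patch[OF P T] by (simp add: patch_def)
  then obtain R where R: "R > 0" "\<And>x. \<exists>y. patch T 0 r \<ominus> y \<subseteq> patch T x R"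
    using rep unfolding repetitive_def by blast
  \<comment> \<open>Agreement at scale \<open>c\<close> extends over a ball of radius at least \<open>R\<close>.\<close>
  define c where "c = min (1 / 2) (1 / (R + 1))"
  have c: "c > 0" "c \<le> 1 / 2" "c \<le> 1 / (R + 1)" using R(1) by (auto simp: c_def)
  have c2: "c \<le> 1 / sqrt 2" using c(2) by (rule le_half_imp_le_dist_bound)
  have "R + 1 \<le> 1 / c" using c R(1) by (simp add: field_simps)
  then have rad: "R \<le> 1 / c - c" using c(2) by simp
  obtain y where "tiling_dist S (T \<ominus> y) < c"
    using S c(1) unfolding mem_tiling_space_iff[OF P T] by blast
  then have "tiling_dist (T \<ominus> y) S < c" by (simp add: tiling_dist_sym)
  then obtain v where v: "patch (T \<ominus> y \<ominus> v) 0 (1 / c - c) = patch S 0 (1 / c - c)"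
    using close_tilings_displacement[OF _ c2] by metis
  obtain z where z: "patch T 0 r \<ominus> z \<subseteq> patch T (y + v) R" using R(2) by blast
  have "patch T 0 r \<ominus> z \<ominus> (y + v) \<subseteq> patch T (y + v) R \<ominus> (y + v)"
    using z unfolding shift_def by (rule image_mono)
  also have "\<dots> = patch (T \<ominus> y \<ominus> v) 0 R" by (simp add: patch_shift)
  also have "\<dots> = patch S 0 R"
    using v by (rule patch_eq_subball) (use rad in simp)
  also have "\<dots> \<subseteq> S" by (simp add: patch_def)
  finally have "patch T 0 r \<ominus> (z + (y + v)) \<subseteq> S" by simp
  then show ?thesis by (rule that)
qed

text \<open>
  Periods pass from a limit back to \<open>T\<close>. A large central patch of \<open>T\<close> occurs in \<open>S\<close>; moving a
  tile of it by the period \<open>u\<close> gives a tile of \<open>S\<close> that still lies over the patch, and so belongs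
  to it.
\<close>

lemma period_of_limit:
  assumes P: "prototile_collection P" and T: "tiling P T" and rep: "repetitive T"
    and S: "S \<in> tiling_space P T" and per: "S \<ominus> u = S"
  shows "T \<ominus> u \<subseteq> T"
proof
  fix t' assume "t' \<in> T \<ominus> u"
  then obtain t where t: "t \<in> T" "t' = tile_minus t u" unfolding shift_def by (rule imageE)
  obtain p where p: "p \<in> fst t" using tile_in_tiling(2)[OF P T t(1)] by blast
  \<comment> \<open>The ball contains a point of the tile both before and after the move by \<open>u\<close>.\<close>
  define r where "r = norm p + norm (p - u) + 1"
  obtain w where w: "patch T 0 r \<ominus> w \<subseteq> S"
    by (rule patch_recurs_in_tiling_space[OF P T rep S])
  have til: "tiling P (S \<ominus> - w)"
    using S tiling_shift[OF P] unfolding mem_tiling_space_iff[OF P T] by blast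
  have sub: "s \<in> S \<ominus> - w" if "s \<in> patch T 0 r" for s
  proof -
    have "tile_minus s w \<in> patch T 0 r \<ominus> w" using that unfolding shift_def by (rule imageI)
    then have "tile_minus s w \<in> S" by (rule subsetD[OF w])
    then show ?thesis by (simp add: mem_shift_iff)
  qed
  have "p \<in> fst t \<inter> cball 0 r" using p by (simp add: r_def)
  then have "t \<in> patch T 0 r" using t(1) unfolding patch_def by blast
  then have "tile_minus t w \<in> S" using sub by (simp add: mem_shift_iff)
  then have "tile_minus (tile_minus t w) u \<in> S \<ominus> u" unfolding shift_def by (rule imageI)
  then have "t' \<in> S \<ominus> - w"
    unfolding per by (simp add: mem_shift_iff t(2) add.commute)
  moreover have "p - u \<in> fst t' \<inter> ball 0 r"
    using p by (simp add: t(2) tile_minus_def r_def add_nonneg_pos)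
  ultimately have "t' \<in> patch T 0 r"
    using sub by (intro tile_in_covering_patch[OF P T til]) auto
  then show "t' \<in> T" by (simp add: patch_def)
qed

lemma aperiodic_tiling_space:
  assumes P: "prototile_collection P" and T: "tiling P T" and "repetitive T" and ap: "aperiodic T"
    and S: "S \<in> tiling_space P T"
  shows "aperiodic S"
  unfolding aperiodic_def
proof (intro allI impI notI)
  fix u assume u: "u \<noteq> 0" and per: "S \<ominus> u = S"
  have "S \<ominus> u \<ominus> - u = S" by simp
  then have "S \<ominus> - u = S" unfolding per .
  then have "T \<ominus> - u \<subseteq> T" by (rule period_of_limit[OF assms(1-3) S])
  then have "T \<ominus> - u \<ominus> u \<subseteq> T \<ominus> u" unfolding shift_def by (rule image_mono)
  then have "T \<subseteq> T \<ominus> u" by simp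
  moreover have "T \<ominus> u \<subseteq> T" by (rule period_of_limit[OF assms(1-3) S per])
  ultimately show False using ap u unfolding aperiodic_def by blast
qed

lemma tiling_spaceD:
  assumes "aperiodic_repetitive_FLC_space P \<Omega>" "S \<in> \<Omega>"
  shows "tiling P S" "S \<ominus> x \<in> \<Omega>" "aperiodic S"
proof -
  obtain T where P: "prototile_collection P" and T: "tiling P T" "aperiodic T" "repetitive T"
    and \<Omega>: "\<Omega> = tiling_space P T"
    using assms(1) unfolding aperiodic_repetitive_FLC_space_def by blast
  have S: "S \<in> tiling_space P T" using assms(2) by (simp add: \<Omega>)
  show "tiling P S" using S unfolding mem_tiling_space_iff[OF P T(1)] by blast
  show "S \<ominus> x \<in> \<Omega>" unfolding \<Omega> by (rule tiling_space_shift[OF P T(1) S])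
  show "aperiodic S" by (rule aperiodic_tiling_space[OF P T(1,3,2) S])
qed

lemma topspace_tiling_space:
  assumes "aperiodic_repetitive_FLC_space P \<Omega>"
  shows "topspace (tiling_space_topology P \<Omega>) = \<Omega>"
proof -
  have P: "prototile_collection P"
    using assms unfolding aperiodic_repetitive_FLC_space_def by blast
  have "topspace (tiling_topology P) = {T. tiling P T}"
    unfolding tiling_topology_def
    by (rule Metric_space.topspace_mtopology[OF Metric_space_tiling[OF P]])
  then show ?thesis
    using tiling_spaceD(1)[OF assms] unfolding tiling_space_topology_def topspace_subtopology by blast
qed

section \<open>The cocycle of a continuous map\<close>

lemma continuous_map_tiling_spaces_uniform:
  assumes \<Omega>: "aperiodic_repetitive_FLC_space P \<Omega>" and \<Omega>': "aperiodic_repetitive_FLC_space P' \<Omega>'"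
    and h: "continuous_map (tiling_space_topology P \<Omega>) (tiling_space_topology P' \<Omega>') h"
    and e: "e > 0"
  obtains d where "d > 0"
    "\<And>S S'. S \<in> \<Omega> \<Longrightarrow> S' \<in> \<Omega> \<Longrightarrow> tiling_dist S S' < d \<Longrightarrow> tiling_dist (h S) (h S') < e"
proof -
  have metric: "Metric_space \<Omega> tiling_dist \<and>
      mtopology_of (metric (\<Omega>, tiling_dist)) = tiling_space_topology P \<Omega>"
    if \<Omega>: "aperiodic_repetitive_FLC_space P \<Omega>"
    for P and \<Omega> :: "('x::finite, 'y) tile set set"
  proof -
    have P: "prototile_collection P"
      using \<Omega> unfolding aperiodic_repetitive_FLC_space_def by blast
    interpret Submetric "{T. tiling P T}" tiling_dist \<Omega>
      using tiling_spaceD(1)[OF \<Omega>]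
      by (intro Submetric.intro Submetric_axioms.intro Metric_space_tiling[OF P]) blast
    show ?thesis
      using mtopology_submetric sub.Metric_space_axioms
      by (simp add: mtopology_of_def sub.mspace_metric sub.mdist_metric
          tiling_space_topology_def tiling_topology_def)
  qed
  interpret M: Metric_space \<Omega> tiling_dist using metric[OF \<Omega>] by blast
  interpret M': Metric_space \<Omega>' tiling_dist using metric[OF \<Omega>'] by blast
  have "compact_space (tiling_space_topology P \<Omega>)"
    using \<Omega> compactin_tiling_space unfolding aperiodic_repetitive_FLC_space_def
      tiling_space_topology_def compactin_subspace by blast
  then have "uniformly_continuous_map (metric (\<Omega>, tiling_dist)) (metric (\<Omega>', tiling_dist)) h"
    using continuous_imp_uniformly_continuous_map[of "metric (\<Omega>, tiling_dist)" "metric (\<Omega>', tiling_dist)" h]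
      metric[OF \<Omega>] metric[OF \<Omega>'] h by simp
  then obtain d where "d > 0"
    "\<forall>S\<in>\<Omega>. \<forall>S'\<in>\<Omega>. tiling_dist S' S < d \<longrightarrow> tiling_dist (h S') (h S) < e"
    using e unfolding uniformly_continuous_map_def M.mspace_metric M.mdist_metric M'.mdist_metric
    by blast
  then show ?thesis using that by blast
qed

text \<open>
  The map \<open>s \<mapsto> h (S \<ominus> s)\<close> on a small ball is a connected family of small diameter, so its values
  lie in one orbit. Compactness makes the size of the ball independent of \<open>S\<close>, and this
  uniformity is the source of both the continuity and the linear growth of the cocycle.
\<close>

lemma local_displacement:
  fixes P' :: "('n::finite, 'm) tile set set" and h :: "('n, 'l) tile set \<Rightarrow> ('n, 'm) tile set"
  assumes \<Omega>: "aperiodic_repetitive_FLC_space P \<Omega>" and \<Omega>': "aperiodic_repetitive_FLC_space P' \<Omega>'"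
    and h: "continuous_map (tiling_space_topology P \<Omega>) (tiling_space_topology P' \<Omega>') h"
    and \<eta>: "\<eta> > 0"
  obtains \<delta> where "\<delta> > 0"
    "\<And>S x. S \<in> \<Omega> \<Longrightarrow> norm x \<le> \<delta> \<Longrightarrow> \<exists>w. norm w \<le> \<eta> \<and> h (S \<ominus> x) = h S \<ominus> w"
proof -
  have P': "prototile_collection P'"
    using \<Omega>' unfolding aperiodic_repetitive_FLC_space_def by blast
  have h_in: "h S \<in> \<Omega>'" if "S \<in> \<Omega>" for S
    using h that unfolding continuous_map_def topspace_tiling_space[OF \<Omega>] topspace_tiling_space[OF \<Omega>']
    by blast
  obtain \<rho> where \<rho>: "\<rho> > 0" and uniq:
    "\<And>(S :: ('n, 'm) tile set) S' v w. tiling P' S \<Longrightarrow> tiling P' S' \<Longrightarrow>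
       patch (S \<ominus> v) 0 0 = patch S' 0 0 \<Longrightarrow> patch (S \<ominus> w) 0 0 = patch S' 0 0 \<Longrightarrow>
       dist v w < \<rho> \<Longrightarrow> v = w"
    using displacement_unique[OF P'] by metis
  define e where "e = Min {1 / 4, \<rho> / 7, \<eta> / 4}"
  have e: "e > 0" "e \<le> 1 / 4" "6 * e < \<rho>" "4 * e \<le> \<eta>"
    using \<rho> \<eta> by (auto simp: e_def min_def)
  note unif = continuous_map_tiling_spaces_uniform[OF \<Omega> \<Omega>' h]
  obtain d where d: "d > 0"
    "\<And>S S'. S \<in> \<Omega> \<Longrightarrow> S' \<in> \<Omega> \<Longrightarrow> tiling_dist S S' < d \<Longrightarrow> tiling_dist (h S) (h S') < e"
    using unif[OF e(1)] by metis
  have "\<exists>w. norm w \<le> \<eta> \<and> h (S \<ominus> x) = h S \<ominus> w" if S: "S \<in> \<Omega>" and x: "norm x \<le> d / 3" for S x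
  proof -
    note Sx = tiling_spaceD(2)[OF \<Omega> S]
    have close: "tiling_dist (S \<ominus> s) (S \<ominus> t) < c" if "dist s t < c" for s t c
      using tiling_dist_shift_le[of S s t] that by (simp add: dist_norm)
    have "\<exists>w. norm w \<le> 4 * e \<and> h (S \<ominus> x) = h (S \<ominus> 0) \<ominus> w"
    proof (rule connected_family_same_orbit[where X = "cball 0 (d / 3)" and \<phi> = "\<lambda>s. h (S \<ominus> s)"])
      show "prototile_collection P'" by (rule P')
      show "v = w" if "tiling P' S1" "tiling P' S2" "patch (S1 \<ominus> v) 0 0 = patch S2 0 0"
        "patch (S1 \<ominus> w) 0 0 = patch S2 0 0" "dist v w < \<rho>" for S1 S2 v w
        by (rule uniq[OF that])
      show "connected (cball (0 :: real ^ 'n) (d / 3))" by (intro convex_connected convex_cball)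
      show "tiling P' (h (S \<ominus> s))" for s by (rule tiling_spaceD(1)[OF \<Omega>' h_in[OF Sx]])
      show "\<exists>c>0. \<forall>t\<in>cball 0 (d / 3). dist s t < c \<longrightarrow> tiling_dist (h (S \<ominus> s)) (h (S \<ominus> t)) < e'"
        if e': "e' > 0" for s e'
      proof -
        obtain c where "c > 0"
          "\<And>S S'. S \<in> \<Omega> \<Longrightarrow> S' \<in> \<Omega> \<Longrightarrow> tiling_dist S S' < c \<Longrightarrow> tiling_dist (h S) (h S') < e'"
          using unif[OF e'] by metis
        then show ?thesis using close Sx by blast
      qed
      show "tiling_dist (h (S \<ominus> s)) (h (S \<ominus> t)) < e"
        if st: "s \<in> cball 0 (d / 3)" "t \<in> cball 0 (d / 3)" for s t
      proof -
        have "dist s t \<le> norm s + norm t" unfolding dist_norm by norm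
        also have "\<dots> < d" using st d(1) by simp
        finally show ?thesis by (intro d(2) Sx close)
      qed
      show "0 < e" "e \<le> 1 / 4" "6 * e < \<rho>" using e by auto
      show "0 \<in> cball 0 (d / 3)" "x \<in> cball 0 (d / 3)" using x d(1) by auto
    qed
    then show ?thesis using e(4) by force
  qed
  then show ?thesis using that[of "d / 3"] d(1) by simp
qed

text \<open>
  The segment from the origin to \<open>x\<close> is cut into \<open>n\<close> equal steps. Each contributes a
  displacement of at most \<open>\<eta>\<close>, whichever tiling of the orbit it starts from.
\<close>

lemma displacement_by_steps:
  assumes shift: "\<And>S x. S \<in> \<Omega> \<Longrightarrow> S \<ominus> x \<in> \<Omega>"
    and loc: "\<And>S x. S \<in> \<Omega> \<Longrightarrow> norm x \<le> \<delta> \<Longrightarrow> \<exists>w. norm w \<le> \<eta> \<and> h (S \<ominus> x) = h S \<ominus> w"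
    and S: "S \<in> \<Omega>" and x: "norm x \<le> real n * \<delta>"
  shows "\<exists>w. norm w \<le> real n * \<eta> \<and> h (S \<ominus> x) = h S \<ominus> w"
  using x
proof (induction n arbitrary: x)
  case 0
  then show ?case by (auto intro!: exI[of _ 0])
next
  case (Suc n)
  define b where "b = (1 / real (Suc n)) *\<^sub>R x"
  define a where "a = real n *\<^sub>R b"
  have ab: "x = a + b"
  proof -
    have "a + b = real (Suc n) *\<^sub>R b" by (simp add: a_def algebra_simps)
    then show ?thesis by (simp add: b_def)
  qed
  have "norm b = norm x / real (Suc n)" by (simp add: b_def divide_inverse mult.commute)
  also have "\<dots> \<le> \<delta>" using Suc.prems by (simp add: pos_divide_le_eq mult.commute)
  finally have nb: "norm b \<le> \<delta>" .
  then have "norm a \<le> real n * \<delta>" unfolding a_def by (simp add: mult_left_mono)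
  then obtain w where w: "norm w \<le> real n * \<eta>" "h (S \<ominus> a) = h S \<ominus> w"
    using Suc.IH by blast
  obtain w' where w': "norm w' \<le> \<eta>" "h (S \<ominus> a \<ominus> b) = h (S \<ominus> a) \<ominus> w'"
    using loc[OF shift[OF S] nb] by blast
  have "h (S \<ominus> x) = h S \<ominus> (w + w')" using w(2) w'(2) by (simp add: ab)
  moreover have "norm (w + w') \<le> real (Suc n) * \<eta>"
    using norm_triangle_ineq[of w w'] w(1) w'(1) by (simp add: algebra_simps)
  ultimately show ?case by blast
qed

lemma aperiodic_shift_inj:
  assumes "aperiodic S" "S \<ominus> a = S \<ominus> b"
  shows "a = b"
proof (rule ccontr)
  assume "a \<noteq> b"
  have "S \<ominus> a \<ominus> - b = S \<ominus> b \<ominus> - b" using assms(2) by simp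
  then have "S \<ominus> (a - b) = S" by simp
  then show False using assms(1) \<open>a \<noteq> b\<close> unfolding aperiodic_def by simp
qed

lemma cocycle_linear_bound:
  fixes P' :: "('n::finite, 'm) tile set set" and h :: "('n, 'l) tile set \<Rightarrow> ('n, 'm) tile set"
  assumes \<Omega>: "aperiodic_repetitive_FLC_space P \<Omega>" and \<Omega>': "aperiodic_repetitive_FLC_space P' \<Omega>'"
    and h: "continuous_map (tiling_space_topology P \<Omega>) (tiling_space_topology P' \<Omega>') h"
  obtains M where "M > 0"
    "\<And>S x. S \<in> \<Omega> \<Longrightarrow> \<exists>w. norm w \<le> M * norm x + 1 \<and> h (S \<ominus> x) = h S \<ominus> w"
proof -
  obtain \<delta> where \<delta>: "\<delta> > 0"
    "\<And>S x. S \<in> \<Omega> \<Longrightarrow> norm x \<le> \<delta> \<Longrightarrow> \<exists>w. norm w \<le> 1 \<and> h (S \<ominus> x) = h S \<ominus> w"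
    using local_displacement[OF assms, of 1] by (metis zero_less_one)
  have "\<exists>w. norm w \<le> 1 / \<delta> * norm x + 1 \<and> h (S \<ominus> x) = h S \<ominus> w" if S: "S \<in> \<Omega>" for S x
  proof -
    define n where "n = nat \<lceil>norm x / \<delta>\<rceil>"
    have nonneg: "norm x / \<delta> \<ge> 0" using \<delta>(1) by simp
    have n: "norm x / \<delta> \<le> real n" unfolding n_def by (rule real_nat_ceiling_ge)
    have n': "real n \<le> norm x / \<delta> + 1" unfolding n_def using nonneg by linarith
    have "norm x \<le> real n * \<delta>" using n \<delta>(1) by (simp add: pos_divide_le_eq)
    then obtain w where "norm w \<le> real n * 1" "h (S \<ominus> x) = h S \<ominus> w"
      using displacement_by_steps[OF tiling_spaceD(2)[OF \<Omega>] \<delta>(2) S] by blast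
    then show ?thesis using n' by (intro exI[of _ w]) simp
  qed
  then show ?thesis using that[of "1 / \<delta>"] \<delta>(1) by simp
qed

lemma cocycle_exists:
  assumes "aperiodic_repetitive_FLC_space P \<Omega>" "aperiodic_repetitive_FLC_space P' \<Omega>'"
    "continuous_map (tiling_space_topology P \<Omega>) (tiling_space_topology P' \<Omega>') h" "S \<in> \<Omega>"
  obtains g where "is_cocycle h S g"
proof -
  obtain M where "\<And>x. \<exists>w. norm w \<le> M * norm x + 1 \<and> h (S \<ominus> x) = h S \<ominus> w"
    using cocycle_linear_bound[OF assms(1-3)] assms(4) by metis
  then have "\<exists>g. \<forall>x. h (S \<ominus> x) = h S \<ominus> g x" by metis
  then show ?thesis using that unfolding is_cocycle_def by blast
qed

lemma cocycle_continuous: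
  fixes P' :: "('n::finite, 'm) tile set set" and h :: "('n, 'l) tile set \<Rightarrow> ('n, 'm) tile set"
  assumes \<Omega>: "aperiodic_repetitive_FLC_space P \<Omega>" and \<Omega>': "aperiodic_repetitive_FLC_space P' \<Omega>'"
    and h: "continuous_map (tiling_space_topology P \<Omega>) (tiling_space_topology P' \<Omega>') h"
    and S: "S \<in> \<Omega>" and ap: "aperiodic (h S)" and g: "is_cocycle h S g"
  shows "continuous_on UNIV g"
  unfolding continuous_on_iff
proof (intro ballI allI impI)
  fix x :: "real ^ 'n" and \<eta> :: real assume "\<eta> > 0"
  then have "\<eta> / 2 > 0" by simp
  then obtain \<delta> where \<delta>: "\<delta> > 0"
    "\<And>S x. S \<in> \<Omega> \<Longrightarrow> norm x \<le> \<delta> \<Longrightarrow> \<exists>w. norm w \<le> \<eta> / 2 \<and> h (S \<ominus> x) = h S \<ominus> w"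
    using local_displacement[OF \<Omega> \<Omega>' h, of "\<eta> / 2"] by metis
  have "dist (g y) (g x) < \<eta>" if y: "dist y x < \<delta>" for y
  proof -
    have "norm (y - x) \<le> \<delta>" using y by (simp add: dist_norm)
    from \<delta>(2)[OF tiling_spaceD(2)[OF \<Omega> S] this, of x]
    obtain w where w: "norm w \<le> \<eta> / 2" "h (S \<ominus> x \<ominus> (y - x)) = h (S \<ominus> x) \<ominus> w"
      by blast
    have "h S \<ominus> g y = h S \<ominus> (g x + w)"
      using w(2) g[unfolded is_cocycle_def, rule_format, of x] g[unfolded is_cocycle_def, rule_format, of y]
      by simp
    then have "g y = g x + w" by (rule aperiodic_shift_inj[OF ap])
    then show ?thesis using w(1) \<open>\<eta> > 0\<close> by (simp add: dist_norm)
  qed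
  then show "\<exists>d>0. \<forall>y\<in>UNIV. dist y x < d \<longrightarrow> dist (g y) (g x) < \<eta>"
    using \<delta>(1) by blast
qed

theorem mainTheorem7:
  fixes P :: "('n::finite, 'l) tile set set" and \<Omega> :: "('n, 'l) tile set set"
    and P' :: "('n, 'm) tile set set" and \<Omega>' :: "('n, 'm) tile set set"
    and h :: "('n, 'l) tile set \<Rightarrow> ('n, 'm) tile set"
  assumes "aperiodic_repetitive_FLC_space P \<Omega>"
    and "aperiodic_repetitive_FLC_space P' \<Omega>'"
    and "homeomorphic_map (tiling_space_topology P \<Omega>) (tiling_space_topology P' \<Omega>') h"
  shows "(\<forall>T\<in>\<Omega>. \<exists>T'\<in>\<Omega>'. h ` orbit T = orbit T') \<and>
    (\<forall>T\<in>\<Omega>. \<exists>!g. is_cocycle h T g) \<and>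
    (\<forall>T\<in>\<Omega>. \<forall>g. is_cocycle h T g \<longrightarrow> homeomorphic_map euclidean euclidean g) \<and>
    (\<exists>M>0. \<exists>C>0. \<forall>T\<in>\<Omega>. \<forall>g. is_cocycle h T g \<longrightarrow>
      (\<forall>x. norm (g x) \<le> M * norm x + C))"
proof -
  note \<Omega> = assms(1) and \<Omega>' = assms(2)
  note top = topspace_tiling_space[OF \<Omega>] topspace_tiling_space[OF \<Omega>']
  obtain k where hk: "homeomorphic_maps (tiling_space_topology P \<Omega>) (tiling_space_topology P' \<Omega>') h k"
    using assms(3) unfolding homeomorphic_map_maps by blast
  then have h: "continuous_map (tiling_space_topology P \<Omega>) (tiling_space_topology P' \<Omega>') h"
    and k: "continuous_map (tiling_space_topology P' \<Omega>') (tiling_space_topology P \<Omega>) k"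
    and kh: "\<And>T. T \<in> \<Omega> \<Longrightarrow> k (h T) = T" and hk: "\<And>T. T \<in> \<Omega>' \<Longrightarrow> h (k T) = T"
    unfolding homeomorphic_maps_def top by blast+
  have h_in: "h T \<in> \<Omega>'" if "T \<in> \<Omega>" for T
    using h that unfolding continuous_map_def top by blast
  have ap: "aperiodic T" "aperiodic (h T)" if "T \<in> \<Omega>" for T
    using tiling_spaceD(3)[OF \<Omega>] tiling_spaceD(3)[OF \<Omega>'] h_in that by blast+
  have uniq: "g x = w" if "T \<in> \<Omega>" "is_cocycle h T g" "h (T \<ominus> x) = h T \<ominus> w" for T g x w
    using aperiodic_shift_inj[OF ap(2)[OF that(1)]] that(2,3) unfolding is_cocycle_def by metis
  have homeo: "homeomorphic_map euclidean euclidean g \<and> h ` orbit T = orbit (h T)"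
    if T: "T \<in> \<Omega>" and g: "is_cocycle h T g" for T g
  proof -
    obtain f where f: "is_cocycle k (h T) f"
      using cocycle_exists[OF \<Omega>' \<Omega> k h_in[OF T]] by blast
    have g': "h (T \<ominus> x) = h T \<ominus> g x" for x using g unfolding is_cocycle_def by blast
    have f': "k (h T \<ominus> y) = T \<ominus> f y" for y using f kh[OF T] unfolding is_cocycle_def by simp
    have fg: "f (g x) = x" for x
    proof -
      have "T \<ominus> f (g x) = k (h (T \<ominus> x))" unfolding g' f' ..
      also have "\<dots> = T \<ominus> x" by (rule kh[OF tiling_spaceD(2)[OF \<Omega> T]])
      finally show ?thesis by (rule aperiodic_shift_inj[OF ap(1)[OF T]])
    qed
    have gf: "g (f y) = y" for y
    proof -
      have "h T \<ominus> g (f y) = h (k (h T \<ominus> y))" unfolding g'[symmetric] f' ..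
      also have "\<dots> = h T \<ominus> y" by (rule hk[OF tiling_spaceD(2)[OF \<Omega>' h_in[OF T]]])
      finally show ?thesis by (rule aperiodic_shift_inj[OF ap(2)[OF T]])
    qed
    have "continuous_on UNIV g" by (rule cocycle_continuous[OF \<Omega> \<Omega>' h T ap(2)[OF T] g])
    moreover have "continuous_on UNIV f"
      by (rule cocycle_continuous[OF \<Omega>' \<Omega> k h_in[OF T] _ f]) (simp add: kh[OF T] ap(1)[OF T])
    ultimately have "homeomorphic_maps euclidean euclidean g f"
      unfolding homeomorphic_maps_def by (simp add: fg gf)
    then have "homeomorphic_map euclidean euclidean g" unfolding homeomorphic_map_maps by blast
    moreover have "h ` orbit T = (\<lambda>y. h T \<ominus> y) ` range g"
      by (simp add: orbit_def image_image g')
    moreover have "surj g" using gf by (rule surjI)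
    ultimately show ?thesis by (simp add: orbit_def)
  qed
  have ex1: "\<exists>!g. is_cocycle h T g" if T: "T \<in> \<Omega>" for T
  proof -
    obtain g where g: "is_cocycle h T g" using cocycle_exists[OF \<Omega> \<Omega>' h T] by blast
    moreover have "g' = g" if "is_cocycle h T g'" for g'
      using uniq[OF T that] g[unfolded is_cocycle_def] by blast
    ultimately show ?thesis by (rule ex1I)
  qed
  obtain M where M: "M > 0"
    "\<And>S x. S \<in> \<Omega> \<Longrightarrow> \<exists>w. norm w \<le> M * norm x + 1 \<and> h (S \<ominus> x) = h S \<ominus> w"
    using cocycle_linear_bound[OF \<Omega> \<Omega>' h] by metis
  have "norm (g x) \<le> M * norm x + 1" if "T \<in> \<Omega>" "is_cocycle h T g" for T g x
    using M(2)[OF that(1), of x] uniq[OF that] by blast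
  then have "\<exists>M>0. \<exists>C>0. \<forall>T\<in>\<Omega>. \<forall>g. is_cocycle h T g \<longrightarrow> (\<forall>x. norm (g x) \<le> M * norm x + C)"
    using M(1) zero_less_one by blast
  moreover have "\<exists>T'\<in>\<Omega>'. h ` orbit T = orbit T'" if T: "T \<in> \<Omega>" for T
  proof -
    obtain g where "is_cocycle h T g" using ex1[OF T] by blast
    from homeo[OF T this] show ?thesis using h_in[OF T] by blast
  qed
  moreover have "homeomorphic_map euclidean euclidean g" if "T \<in> \<Omega>" "is_cocycle h T g" for T g
    using homeo[OF that] by blast
  ultimately show ?thesis using ex1 by (intro conjI ballI allI impI)
qed

end
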